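(* Let $k>2$ and $D\ge 2k+1$, and consider the BRST complex of the free massless tensor field $t_{\mu_1\cdots\mu_k|\nu_1\cdots\nu_k}$ with mixed symmetry $(k,k)$ described in the context. Then the cohomology $H^l(\gamma)$ of the exterior longitudinal derivative $\gamma$ in the space of local functions (polynomials in the fields, ghosts, antifields and finitely many of their spacetime derivatives) vanishes in every pure ghost number $l$ with $1\le l\le k-1$: every $\gamma$-closed local function $a$ with $\mathrm{pgh}(a)=l$, $1\le l\le k-1$, is $\gamma$-exact.
   Context: Work on $\mathbb{R}^D$ with metric $\sigma_{\mu\nu}=\mathrm{diag}(-1,1,\dots,1)$. A tensor has mixed symmetry $(p,q)$, $p\ge q$, if it is separately antisymmetric in its first $p$ and in its last $q$ indices and its complete antisymmetrization over the first $p$ indices together with any one of the last $q$ indices vanishes. Brackets $[\cdots]$ denote antisymmetrization written as the signed sum over the distinct terms only, with no normalization factor; $f_{,\mu}=\partial_\mu f$. The field $t_{\mu_1\cdots\mu_k|\nu_1\cdots\nu_k}$ is real, has mixed symmetry $(k,k)$ and is symmetric under exchange of the two groups of indices. The ghosts are $\eta^{(m)}_{\mu_1\cdots\mu_k|\nu_1\cdots\nu_{k-m-1}}$, $m=0,\dots,k-1$, of Grassmann parity $(m+1)\bmod 2$, with mixed symmetry $(k,k-m-1)$ ($\eta^{(k-1)}_{\mu_1\cdots\mu_k}$ is completely antisymmetric). The antifields are $t^{*\mu_1\cdots\mu_k|\nu_1\cdots\nu_k}$ (odd, same symmetry as $t$) and $\eta^{(m)*\mu_1\cdots\mu_k|\nu_1\cdots\nu_{k-m-1}}$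 (parity $m\bmod 2$, same symmetry as $\eta^{(m)}$). Pure ghost numbers: $\mathrm{pgh}(t)=0$, $\mathrm{pgh}(\eta^{(m)})=m+1$, all antifields have $\mathrm{pgh}=0$. The differential $\gamma$ (of $\mathrm{pgh}$ 1, acting as a right derivation commuting with $\partial_\mu$) is defined by $\gamma t_{\mu_1\cdots\mu_k|\nu_1\cdots\nu_k}=\eta^{(0)}_{\mu_1\cdots\mu_k|[\nu_2\cdots\nu_k,\nu_1]}+\eta^{(0)}_{\nu_1\cdots\nu_k|[\mu_2\cdots\mu_k,\mu_1]}$; $\gamma\eta^{(m)}_{\mu_1\cdots\mu_k|\nu_1\cdots\nu_{k-m-1}}=\partial_{[\mu_1}\eta^{(m+1)}_{\mu_2\cdots\mu_k][\nu_1|\nu_2\cdots\nu_{k-m-1}]}+(-1)^{k+1}(m+2)\eta^{(m+1)}_{\mu_1\cdots\mu_k|[\nu_2\cdots\nu_{k-m-1},\nu_1]}$ for $m=0,\dots,k-2$; $\gamma\eta^{(k-1)}_{\mu_1\cdots\mu_k}=0$; and $\gamma$ annihilates all antifields. *)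

theory Defs
  imports Complex_Main "HOL-Library.Multiset" "HOL-Combinatorics.Permutations"
begin

text \<open>Jet generators of the algebra of local functions.
  Fld = t, FldS = t^*, Gh m = eta^(m), GhS m = eta^(m)*.
  A generator  Gen K xs ys d  is the component with first index group xs,
  second index group ys, differentiated by the multiset d of spacetime indices
  (derivatives commute).  Indices range over 0..D-1.\<close>

datatype kind = Fld | FldS | Gh nat | GhS nat

text \<open>Syntactic local functions (polynomial expressions with real coefficients);
  the actual algebra is the quotient by the congruence lf_eq below.\<close>
datatype lf = Gen kind "nat list" "nat list" "nat multiset" | Cst real | Add lf lf | Mul lf lf

fun odd_kind :: "kind \<Rightarrow> bool" where
  "odd_kind Fld = False"
| "odd_kind FldS = True"
| "odd_kind (Gh m) = even m"
| "odd_kind (GhS m) = odd m"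

fun pgh_kind :: "kind \<Rightarrow> nat" where
  "pgh_kind (Gh m) = m + 1"
| "pgh_kind _ = 0"

definition valid_gen :: "nat \<Rightarrow> nat \<Rightarrow> kind \<Rightarrow> nat list \<Rightarrow> nat list \<Rightarrow> nat multiset \<Rightarrow> bool" where
  "valid_gen k D K xs ys d \<longleftrightarrow>
     length xs = k \<and>
     (case K of Fld \<Rightarrow> length ys = k | FldS \<Rightarrow> length ys = k
        | Gh m \<Rightarrow> m < k \<and> length ys = k - m - 1
        | GhS m \<Rightarrow> m < k \<and> length ys = k - m - 1) \<and>
     (\<forall>i\<in>set xs. i < D) \<and> (\<forall>i\<in>set ys. i < D) \<and> (\<forall>i\<in>#d. i < D)"

definition smul :: "real \<Rightarrow> lf \<Rightarrow> lf" where
  "smul c e = Mul (Cst c) e"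

definition lsum :: "lf list \<Rightarrow> lf" where
  "lsum es = foldr Add es (Cst 0)"

definition delete_at :: "nat \<Rightarrow> 'a list \<Rightarrow> 'a list" where
  "delete_at j xs = take j xs @ drop (Suc j) xs"

fun dlf :: "nat \<Rightarrow> lf \<Rightarrow> lf" where
  "dlf \<mu> (Gen K xs ys d) = Gen K xs ys (add_mset \<mu> d)"
| "dlf \<mu> (Cst c) = Cst 0"
| "dlf \<mu> (Add a b) = Add (dlf \<mu> a) (dlf \<mu> b)"
| "dlf \<mu> (Mul a b) = Add (Mul (dlf \<mu> a) b) (Mul a (dlf \<mu> b))"

definition derivs :: "nat multiset \<Rightarrow> lf \<Rightarrow> lf" where
  "derivs d e = fold dlf (sorted_list_of_multiset d) e"

text \<open>The antisymmetrisation  X_{mus|[nus_2..nus_n, nus_1]}  of  partial_{nu_1} eta^(m)_{mus|nu_2..nu_n},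
  written as signed sum over the distinct terms.\<close>
definition curl2 :: "nat \<Rightarrow> nat list \<Rightarrow> nat list \<Rightarrow> lf" where
  "curl2 m \<mu>s \<nu>s = lsum (map (\<lambda>j. smul ((-1)^j)
       (dlf (\<nu>s ! j) (Gen (Gh m) \<mu>s (delete_at j \<nu>s) {#}))) [0..<length \<nu>s])"

text \<open>partial_{[mu_1} eta^(m)_{mu_2..mu_k][nu_1|nu_2..nu_n]}, signed sum over distinct terms.\<close>
definition curl12 :: "nat \<Rightarrow> nat list \<Rightarrow> nat list \<Rightarrow> lf" where
  "curl12 m \<mu>s \<nu>s = lsum [smul ((-1)^(i+j))
       (dlf (\<mu>s ! i) (Gen (Gh m) (delete_at i \<mu>s @ [\<nu>s ! j]) (delete_at j \<nu>s) {#})).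
       i \<leftarrow> [0..<length \<mu>s], j \<leftarrow> [0..<length \<nu>s]]"

definition gamma_gen :: "nat \<Rightarrow> kind \<Rightarrow> nat list \<Rightarrow> nat list \<Rightarrow> lf" where
  "gamma_gen k K xs ys = (case K of
      Fld \<Rightarrow> Add (curl2 0 xs ys) (curl2 0 ys xs)
    | Gh m \<Rightarrow> (if m + 2 \<le> k then
                 Add (curl12 (m+1) xs ys) (smul ((-1)^(k+1) * real (m+2)) (curl2 (m+1) xs ys))
               else Cst 0)
    | _ \<Rightarrow> Cst 0)"

fun par :: "lf \<Rightarrow> lf" where
  "par (Gen K xs ys d) = (if odd_kind K then smul (-1) (Gen K xs ys d) else Gen K xs ys d)"
| "par (Cst c) = Cst c"
| "par (Add a b) = Add (par a) (par b)"
| "par (Mul a b) = Mul (par a) (par b)"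

text \<open>gamma: odd right derivation commuting with partial_mu:
  gamma(a b) = a gamma(b) + (-1)^{eps_b} gamma(a) b.\<close>
fun gamma :: "nat \<Rightarrow> nat \<Rightarrow> lf \<Rightarrow> lf" where
  "gamma k D (Gen K xs ys d) =
     (if valid_gen k D K xs ys d then derivs d (gamma_gen k K xs ys) else Cst 0)"
| "gamma k D (Cst c) = Cst 0"
| "gamma k D (Add a b) = Add (gamma k D a) (gamma k D b)"
| "gamma k D (Mul a b) = Add (Mul a (gamma k D b)) (Mul (gamma k D a) (par b))"

inductive_set rels :: "nat \<Rightarrow> nat \<Rightarrow> lf set" for k D where
  invalid: "\<not> valid_gen k D K xs ys d \<Longrightarrow> Gen K xs ys d \<in> rels k D"
| antisym1: "\<sigma> permutes {..<length xs} \<Longrightarrow>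
     Add (Gen K (permute_list \<sigma> xs) ys d) (smul (- of_int (sign \<sigma>)) (Gen K xs ys d)) \<in> rels k D"
| antisym2: "\<sigma> permutes {..<length ys} \<Longrightarrow>
     Add (Gen K xs (permute_list \<sigma> ys) d) (smul (- of_int (sign \<sigma>)) (Gen K xs ys d)) \<in> rels k D"
| young: "j < length ys \<Longrightarrow>
     Add (Gen K xs ys d)
         (smul (-1) (lsum (map (\<lambda>i. Gen K (xs[i := ys ! j]) (ys[j := xs ! i]) d) [0..<length xs])))
       \<in> rels k D"
| exch: "K = Fld \<or> K = FldS \<Longrightarrow> Add (Gen K xs ys d) (smul (-1) (Gen K ys xs d)) \<in> rels k D"

text \<open>Equality in the algebra of local functions: the free graded-commutative real algebra
  on the jet generators modulo the ideal generated by rels.\<close>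
inductive lf_eq :: "nat \<Rightarrow> nat \<Rightarrow> lf \<Rightarrow> lf \<Rightarrow> bool" for k D where
  refl: "lf_eq k D a a"
| sym: "lf_eq k D a b \<Longrightarrow> lf_eq k D b a"
| trans: "lf_eq k D a b \<Longrightarrow> lf_eq k D b c \<Longrightarrow> lf_eq k D a c"
| add_cong: "lf_eq k D a a' \<Longrightarrow> lf_eq k D b b' \<Longrightarrow> lf_eq k D (Add a b) (Add a' b')"
| mul_cong: "lf_eq k D a a' \<Longrightarrow> lf_eq k D b b' \<Longrightarrow> lf_eq k D (Mul a b) (Mul a' b')"
| add_assoc: "lf_eq k D (Add (Add a b) c) (Add a (Add b c))"
| add_comm: "lf_eq k D (Add a b) (Add b a)"
| add_zero: "lf_eq k D (Add a (Cst 0)) a"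
| add_neg: "lf_eq k D (Add a (Mul (Cst (-1)) a)) (Cst 0)"
| mul_assoc: "lf_eq k D (Mul (Mul a b) c) (Mul a (Mul b c))"
| mul_one_l: "lf_eq k D (Mul (Cst 1) a) a"
| mul_one_r: "lf_eq k D (Mul a (Cst 1)) a"
| distrib_l: "lf_eq k D (Mul a (Add b c)) (Add (Mul a b) (Mul a c))"
| distrib_r: "lf_eq k D (Mul (Add a b) c) (Add (Mul a c) (Mul b c))"
| cst_add: "lf_eq k D (Add (Cst x) (Cst y)) (Cst (x + y))"
| cst_mul: "lf_eq k D (Mul (Cst x) (Cst y)) (Cst (x * y))"
| cst_central: "lf_eq k D (Mul (Cst x) a) (Mul a (Cst x))"
| supercomm: "lf_eq k D (Mul (Gen K xs ys d) (Gen K' xs' ys' d'))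
     (Mul (Cst (if odd_kind K \<and> odd_kind K' then -1 else 1)) (Mul (Gen K' xs' ys' d') (Gen K xs ys d)))"
| rel: "r \<in> rels k D \<Longrightarrow> lf_eq k D r (Cst 0)"

fun pgh_hom :: "nat \<Rightarrow> lf \<Rightarrow> bool" where
  "pgh_hom n (Gen K xs ys d) = (pgh_kind K = n)"
| "pgh_hom n (Cst c) = (n = 0 \<or> c = 0)"
| "pgh_hom n (Add a b) = (pgh_hom n a \<and> pgh_hom n b)"
| "pgh_hom n (Mul a b) = (\<exists>i\<le>n. pgh_hom i a \<and> pgh_hom (n - i) b)"

end

theory Submission
  imports Defs "HOL-Library.Function_Algebras"
begin

text \<open>On generators the complex is linear. A generator of the ghost tower is a word in odd letters
  (first column), odd letters (second column) and even letters (derivatives), and \<open>gl(2|1)\<close> acts on such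
  words by polarizations \<open>E\<^sub>i\<^sub>j\<close> turning letters of kind \<open>j\<close> into letters of kind \<open>i\<close>. Modulo the Young
  relations (the image of \<open>E\<^sub>2\<^sub>1\<close>), \<open>\<gamma>\<close> is \<open>E\<^sub>1\<^sub>2 E\<^sub>x\<^sub>1 - (m + 2) E\<^sub>x\<^sub>2\<close>. Take for \<open>h\<close> the odd derivation
  \<open>- E\<^sub>2\<^sub>x\<close>, which moves a derivative index into the second column. On generators with \<open>q\<close> letters in
  the second column and \<open>n\<close> derivatives, \<open>L = \<gamma> h + h \<gamma>\<close> is
  \<open>(k - q)(q + n - 1) + E\<^sub>1\<^sub>x E\<^sub>x\<^sub>1 + E\<^sub>2\<^sub>x E\<^sub>x\<^sub>2\<close>; it is diagonalizable, with nonnegative eigenvalues, which are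
  positive in pure ghost numbers \<open>1, \<dots>, k - 1\<close>. As \<open>L\<close> is an even derivation, every local function of pure
  ghost number \<open>l\<close> with \<open>1 \<le> l \<le> k - 1\<close> is a sum of eigenvectors of \<open>L\<close> with positive eigenvalues, and
  since \<open>L\<close> commutes with \<open>\<gamma>\<close>, inverting \<open>L\<close> turns the homotopy into exactness.\<close>

section \<open>Polarization operators on words\<close>

instantiation "fun" :: (type, real_vector) real_vector
begin
definition "c *\<^sub>R f = (\<lambda>x. c *\<^sub>R f x)"
instance
  by standard (auto simp: scaleR_fun_def fun_eq_iff scaleR_add_right scaleR_add_left)
end

lemma scaleR_fun_apply [simp]: "(c *\<^sub>R f) x = c *\<^sub>R f x"
  by (simp add: scaleR_fun_def)

datatype slot = First | Second | Deriv

type_synonym 'i word = "(slot \<times> 'i) list"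

definition odd_slot :: "slot \<Rightarrow> bool" where
  "odd_slot s \<longleftrightarrow> s \<noteq> Deriv"

definition koszul :: "bool \<Rightarrow> bool \<Rightarrow> real" where
  "koszul p q = (if p \<and> q then -1 else 1)"

text \<open>\<open>polar i j F\<close> is \<open>F \<circ> E\<^sub>i\<^sub>j\<close>, so the operators compose in the opposite order to the \<open>E\<^sub>i\<^sub>j\<close>.\<close>

fun polar :: "slot \<Rightarrow> slot \<Rightarrow> ('i word \<Rightarrow> 'a::real_vector) \<Rightarrow> 'i word \<Rightarrow> 'a" where
  "polar i j F [] = 0"
| "polar i j F (l # w) = (if fst l = j then F ((i, snd l) # w) else 0) +
     koszul (odd_slot i \<noteq> odd_slot j) (odd_slot (fst l)) *\<^sub>R polar i j (\<lambda>u. F (l # u)) w"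

text \<open>This lets linear maps of the target, such as the lifts of the two derivations, pass
  under every polarization.\<close>

lemma polar_linear_comp:
  assumes "linear f"
  shows "polar i j (\<lambda>u. f (F u)) w = f (polar i j F w)"
  by (induction w arbitrary: F)
     (auto simp: linear_0[OF assms] linear_add[OF assms] linear_scale[OF assms])

lemma polar_add_app: "polar i j (\<lambda>u. F u + G u) w = polar i j F w + polar i j G w"
  by (induction w arbitrary: F G) (auto simp: scaleR_add_right)

lemma polar_scale_app: "polar i j (\<lambda>u. c *\<^sub>R F u) w = c *\<^sub>R polar i j F w"
  by (rule polar_linear_comp) (simp add: linear_scale_self)

lemma polar_zero_app: "polar i j (\<lambda>u. 0) w = 0"
  by (induction w) auto

lemma polar_add: "polar i j (F + G) = polar i j F + polar i j G"
  by (simp add: fun_eq_iff plus_fun_def polar_add_app)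

lemma polar_scale: "polar i j (c *\<^sub>R F) = c *\<^sub>R polar i j F"
  by (simp add: fun_eq_iff scaleR_fun_def polar_scale_app)

lemma linear_polar: "linear (polar i j)"
  by (rule linearI) (simp_all add: polar_add polar_scale)

lemmas polar_zero = linear_0[OF linear_polar]
  and polar_diff = linear_diff[OF linear_polar]
  and polar_minus = linear_neg[OF linear_polar]

lemma polar_if_app: "polar i j (\<lambda>u. if b then F u else 0) w = (if b then polar i j F w else 0)"
  by (simp add: polar_zero_app)

lemma koszul_simps [simp]: "koszul False q = 1" "koszul p False = 1" "koszul True True = -1"
  by (auto simp: koszul_def)

text \<open>These are the \<open>gl(2|1)\<close> relations. Splitting off the first letter gives a
  term where both operators hit it, mixed terms that cancel up to the Koszul sign, and the relation
  for the remaining word.\<close>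

lemma polar_supercommute_app:
  fixes F :: "'i word \<Rightarrow> 'a::real_vector"
  shows "polar i j (polar k l F) w =
     koszul (odd_slot i \<noteq> odd_slot j) (odd_slot k \<noteq> odd_slot l) *\<^sub>R
       (polar k l (polar i j F) w - (if j = k then polar i l F w else 0))
     + (if l = i then polar k j F w else 0)"
proof (induction w arbitrary: F)
  case Nil
  show ?case by simp
next
  case (Cons a w)
  obtain c x where a: "a = (c, x)" by (cases a)
  define Fa where "Fa = (\<lambda>u. F (a # u))"
  define A where "A = polar i j (polar k l Fa) w"
  define B where "B = polar k l (polar i j Fa) w"
  have exp: "polar i j (polar k l F) (a # w) =
      (if c = j then polar k l F ((i, x) # w) else 0) +
      koszul (odd_slot i \<noteq> odd_slot j) (odd_slot c) *\<^sub>R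
      (polar i j (\<lambda>u. (if c = l then F ((k, x) # u) else 0)) w +
       koszul (odd_slot k \<noteq> odd_slot l) (odd_slot c) *\<^sub>R A)"
    if "A = polar i j (polar k l Fa) w" for i j k l A
    by (simp add: a that Fa_def polar_add_app polar_scale_app cong: if_cong)
  have IH: "A = koszul (odd_slot i \<noteq> odd_slot j) (odd_slot k \<noteq> odd_slot l) *\<^sub>R
       (B - (if j = k then polar i l Fa w else 0)) + (if l = i then polar k j Fa w else 0)"
    using Cons.IH[of Fa] by (simp add: A_def B_def)
  show ?case
    unfolding exp[OF A_def] exp[OF B_def] unfolding IH
    by (cases i; cases j; cases k; cases l; cases c)
       (simp_all add: a Fa_def polar_zero_app odd_slot_def koszul_def
          scaleR_add_right scaleR_diff_right)
qed

lemma polar_supercommute: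
  "polar i j (polar k l F) =
     koszul (odd_slot i \<noteq> odd_slot j) (odd_slot k \<noteq> odd_slot l) *\<^sub>R
       (polar k l (polar i j F) - (if j = k then polar i l F else 0))
     + (if l = i then polar k j F else 0)"
proof (rule ext)
  show "polar i j (polar k l F) w = (koszul (odd_slot i \<noteq> odd_slot j) (odd_slot k \<noteq> odd_slot l) *\<^sub>R
       (polar k l (polar i j F) - (if j = k then polar i l F else 0))
     + (if l = i then polar k j F else 0)) w" for w
    unfolding polar_supercommute_app[of i j k l F w] by simp
qed

lemma eq_minus_self_imp_zero: "x = - x \<Longrightarrow> x = (0 :: 'a::real_vector)"
  by (metis add.inverse_unique add_eq_0_iff real_vector_eq_affinity scaleR_2 scaleR_eq_0_iff zero_neq_numeral)

lemma polar_square_zero: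
  assumes "odd_slot i \<noteq> odd_slot j"
  shows "polar i j (polar i j F) = 0"
  using polar_supercommute[of i j i j F] assms
  by (intro eq_minus_self_imp_zero) (auto simp: koszul_def split: if_splits)

lemmas polar_linear = polar_add polar_scale polar_zero polar_diff polar_minus

text \<open>Oriented for rewriting: \<open>polar Deriv _\<close> moves outermost, then
  \<open>polar _ Deriv\<close>, then \<open>polar First Second\<close>, while
  \<open>polar Second First\<close> is pushed innermost, where the Young condition kills it.\<close>

lemma polar_normal_order:
  shows "polar Deriv First (polar Deriv First F) = 0"
    and "polar Deriv Second (polar Deriv Second F) = 0"
    and "polar Deriv Second (polar Deriv First F) = - polar Deriv First (polar Deriv Second F)"
    and "polar First Deriv (polar First Deriv F) = 0"
    and "polar Second Deriv (polar Second Deriv F) = 0"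
    and "polar Second Deriv (polar First Deriv F) = - polar First Deriv (polar Second Deriv F)"
    and "polar First Deriv (polar Deriv First F) =
      - polar Deriv First (polar First Deriv F) + polar First First F + polar Deriv Deriv F"
    and "polar Second Deriv (polar Deriv Second F) =
      - polar Deriv Second (polar Second Deriv F) + polar Second Second F + polar Deriv Deriv F"
    and "polar First Deriv (polar Deriv Second F) =
      - polar Deriv Second (polar First Deriv F) + polar First Second F"
    and "polar Second Deriv (polar Deriv First F) =
      - polar Deriv First (polar Second Deriv F) + polar Second First F"
    and "polar First Second (polar Deriv First F) =
      polar Deriv First (polar First Second F) + polar Deriv Second F"
    and "polar First Second (polar Deriv Second F) = polar Deriv Second (polar First Second F)"
    and "polar First Second (polar First Deriv F) = polar First Deriv (polar First Second F)"
    and "polar First Second (polar Second Deriv F) =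
      polar Second Deriv (polar First Second F) - polar First Deriv F"
    and "polar Second First (polar Deriv First F) = polar Deriv First (polar Second First F)"
    and "polar Second First (polar Deriv Second F) =
      polar Deriv Second (polar Second First F) + polar Deriv First F"
    and "polar Second First (polar First Deriv F) =
      polar First Deriv (polar Second First F) - polar Second Deriv F"
    and "polar Second First (polar Second Deriv F) = polar Second Deriv (polar Second First F)"
    and "polar Second First (polar First Second F) =
      polar First Second (polar Second First F) - polar Second Second F + polar First First F"
  by (simp_all add: polar_square_zero odd_slot_def)
     (simp_all add: polar_supercommute[where i = Deriv and j = Second and k = Deriv and l = First]
       polar_supercommute[where i = Second and j = Deriv and k = First and l = Deriv]
       polar_supercommute[where i = First and j = Deriv and k = Deriv]
       polar_supercommute[where i = Second and j = Deriv and k = Deriv]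
       polar_supercommute[where i = First and j = Second and k = Deriv]
       polar_supercommute[where i = First and j = Second and l = Deriv]
       polar_supercommute[where i = Second and j = First and k = Deriv]
       polar_supercommute[where i = Second and j = First and l = Deriv]
       polar_supercommute[where i = Second and j = First and k = First and l = Second]
       odd_slot_def)

lemma polar_weight:
  assumes "k \<noteq> l"
  shows "polar i i (polar k l F) =
    polar k l (polar i i F) - (if i = k then polar k l F else 0) + (if l = i then polar k l F else 0)"
  by (subst polar_supercommute) (auto simp: odd_slot_def koszul_def)

section \<open>The odd part of the Casimir operator and its annihilating polynomial\<close>

definition casimir :: "('i word \<Rightarrow> 'a::real_vector) \<Rightarrow> 'i word \<Rightarrow> 'a" where
  "casimir F = polar Deriv First (polar First Deriv F) + polar Deriv Second (polar Second Deriv F)"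

lemma linear_casimir: "linear casimir"
  by (rule linearI) (simp_all add: casimir_def polar_linear algebra_simps)

lemmas casimir_linear = linear_add[OF linear_casimir] linear_scale[OF linear_casimir]
  linear_0[OF linear_casimir] linear_diff[OF linear_casimir] linear_neg[OF linear_casimir]

definition casimir_minus :: "real \<Rightarrow> ('i word \<Rightarrow> 'a::real_vector) \<Rightarrow> 'i word \<Rightarrow> 'a" where
  "casimir_minus c F = casimir F - c *\<^sub>R F"

definition grad :: "real \<Rightarrow> ('i word \<Rightarrow> 'a::real_vector) \<Rightarrow> 'i word \<Rightarrow> 'a" where
  "grad r F = polar Deriv First (polar First Second F) - r *\<^sub>R polar Deriv Second F"

text \<open>Algebraic core of the nilpotency of \<gamma>: normal ordering leaves only \<open>polar
  Deriv First (polar Deriv Second (polar First Second F))\<close>, with coefficient 1 - (r + 1) +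
  r.\<close>

lemma grad_grad: "grad r (grad (r + 1) F) = 0"
  by (simp add: grad_def polar_linear polar_normal_order algebra_simps scaleR_add_left)

text \<open>The Young condition says that \<open>F\<close> is a highest-weight vector for the
  \<open>gl(2)\<close> mixing the two columns.\<close>

locale highest_weight =
  fixes F :: "'i word \<Rightarrow> 'a::real_vector" and p q n :: real
  assumes weight_First: "polar First First F = p *\<^sub>R F"
    and weight_Second: "polar Second Second F = q *\<^sub>R F"
    and weight_Deriv: "polar Deriv Deriv F = n *\<^sub>R F"
    and young: "polar Second First F = 0"
begin

lemmas hw = weight_First weight_Second weight_Deriv young polar_normal_order polar_weight polar_linear

text \<open>Together with \<open>F\<close> these span a subspace stable under \<open>casimir\<close>.\<close>

definition "v1 = polar Deriv First (polar First Deriv F)"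
definition "v2 = polar Deriv Second (polar Second Deriv F)"
definition "v3 = polar Deriv First (polar Second Deriv (polar First Second F))"
definition "v4 = polar Deriv First (polar Deriv Second (polar First Deriv (polar Second Deriv F)))"

lemma casimir_v1: "casimir v1 = (p + n) *\<^sub>R v1 - v2 - v4"
  unfolding casimir_def v1_def v2_def v4_def by (simp add: hw scaleR_add_left scaleR_diff_left)

lemma casimir_v2: "casimir v2 = (q + n) *\<^sub>R v2 - v4 + v3 - v1"
  unfolding casimir_def v1_def v2_def v3_def v4_def by (simp add: hw scaleR_add_left scaleR_diff_left)

lemma casimir_v3: "casimir v3 = (p + n) *\<^sub>R v3 + (p - q) *\<^sub>R v2"
  unfolding casimir_def v2_def v3_def by (simp add: hw scaleR_add_left scaleR_diff_left)

lemma casimir_v4: "casimir v4 = (p + q + 2 * n) *\<^sub>R v4"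
  unfolding casimir_def v4_def
  by (simp add: hw scaleR_add_left scaleR_diff_left) (simp flip: scaleR_add_left)

lemma casimir_F: "casimir F = v1 + v2"
  by (simp add: casimir_def v1_def v2_def)

text \<open>The action on \<open>v1\<close>, ..., \<open>v4\<close> is triangular enough to remove
  one eigenvalue at a time: two factors leave a combination of \<open>y\<close> and
  \<open>v4\<close>, the third leaves a multiple of \<open>v4\<close>, and \<open>v4\<close> is an
  eigenvector.\<close>

lemma casimir_annihilator:
  "casimir_minus (p + q + 2 * n) (casimir_minus (q + n - 1) (casimir_minus (p + n) (casimir F))) = 0"
proof -
  \<comment> \<open>Modulo \<open>v4\<close> this is an eigenvector with eigenvalue q + n -
    1.\<close>
  define y where "y = (q - p - 1) *\<^sub>R v2 + v3 - v1"
  have 1: "casimir_minus (p + n) (casimir F) = y - 2 *\<^sub>R v4"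
    by (simp add: casimir_minus_def casimir_linear casimir_F casimir_v1 casimir_v2 y_def
        scaleR_add_left scaleR_diff_left scaleR_add_right scaleR_2)
  have y: "casimir y = (q + n - 1) *\<^sub>R y - (q - p - 2) *\<^sub>R v4"
    by (simp add: casimir_linear casimir_v1 casimir_v2 casimir_v3 y_def
        scaleR_add_left scaleR_diff_left scaleR_add_right scaleR_diff_right scaleR_2)
       (simp add: algebra_simps)
  have 2: "casimir_minus (q + n - 1) (y - 2 *\<^sub>R v4) = - ((p + q + 2 * n) *\<^sub>R v4)"
    by (simp add: casimir_minus_def casimir_linear y casimir_v4
        scaleR_add_left scaleR_diff_left scaleR_add_right scaleR_diff_right scaleR_2)
       (simp add: algebra_simps flip: scaleR_add_left)
  show ?thesis
    unfolding 1 2 by (simp add: casimir_minus_def casimir_linear casimir_v4)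
qed

end

section \<open>Weights and \<open>sl(2)\<close> strings\<close>

definition proj :: "slot \<Rightarrow> 'i word \<Rightarrow> 'i list" where
  "proj c w = map snd (filter (\<lambda>l. fst l = c) w)"

lemma proj_simps [simp]:
  "proj c [] = []"
  "proj c (l # w) = (if fst l = c then snd l # proj c w else proj c w)"
  "proj c (u @ w) = proj c u @ proj c w"
  by (auto simp: proj_def)

lemma proj_map_Pair [simp]: "proj c (map (Pair c') xs) = (if c = c' then xs else [])"
  by (induction xs) auto

lemma polar_diagonal: "polar i i F w = real (length (proj i w)) *\<^sub>R F w"
  by (induction w arbitrary: F) (auto simp: scaleR_add_left)

lemma weight_support:
  assumes "polar i i F = real m *\<^sub>R F" "length (proj i w) \<noteq> m"
  shows "F w = 0"
  using polar_diagonal[of i F w] assms by simp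

text \<open>Each step moves one unit of weight from the first column to the second. The factor in
  the last claim is the sum of the weight differences p - q - 2 i over i \<le> m.\<close>

lemma polar_raising_power:
  assumes "polar First First F = p *\<^sub>R F" "polar Second Second F = q *\<^sub>R F" "polar Second First F = 0"
  defines "U \<equiv> \<lambda>m. (polar First Second ^^ m) F"
  shows "polar First First (U m) = (p - real m) *\<^sub>R U m"
    and "polar Second Second (U m) = (q + real m) *\<^sub>R U m"
    and "polar Second First (U (Suc m)) = (real (Suc m) * (p - q - real m)) *\<^sub>R U m"
proof -
  have weight: "polar i i (U (Suc m)) = polar First Second (polar i i (U m))
      - (if i = First then U (Suc m) else 0) + (if i = Second then U (Suc m) else 0)" for i m
    unfolding U_def funpow.simps o_def by (subst polar_weight) auto
  show 1: "polar First First (U m) = (p - real m) *\<^sub>R U m" for m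
  proof (induction m)
    case (Suc m)
    have "polar First First (U (Suc m)) = (p - real m) *\<^sub>R U (Suc m) - U (Suc m)"
      unfolding weight Suc.IH polar_scale by (simp add: U_def)
    also have "\<dots> = (p - real m - 1) *\<^sub>R U (Suc m)"
      unfolding scaleR_diff_left[of _ 1] by simp
    also have "p - real m - 1 = p - real (Suc m)" by simp
    finally show ?case .
  qed (simp add: U_def assms)
  show 2: "polar Second Second (U m) = (q + real m) *\<^sub>R U m" for m
  proof (induction m)
    case (Suc m)
    have "polar Second Second (U (Suc m)) = (q + real m) *\<^sub>R U (Suc m) + U (Suc m)"
      unfolding weight Suc.IH polar_scale by (simp add: U_def)
    also have "\<dots> = (q + real m + 1) *\<^sub>R U (Suc m)"
      unfolding scaleR_add_left[of _ 1] by simp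
    also have "q + real m + 1 = q + real (Suc m)" by simp
    finally show ?case .
  qed (simp add: U_def assms)
  show "polar Second First (U (Suc m)) = (real (Suc m) * (p - q - real m)) *\<^sub>R U m"
  proof (induction m)
    case 0
    have "polar Second First (U (Suc 0)) = polar Second First (polar First Second F)"
      by (simp add: U_def)
    also have "\<dots> = (p - q) *\<^sub>R F"
      by (simp only: polar_normal_order assms polar_zero) (simp add: scaleR_diff_left)
    finally show ?case by (simp add: U_def)
  next
    case (Suc m)
    have "polar Second First (U (Suc (Suc m))) =
        polar First Second (polar Second First (U (Suc m)))
        - polar Second Second (U (Suc m)) + polar First First (U (Suc m))"
      unfolding U_def funpow.simps o_def by (rule polar_normal_order)
    also have "\<dots> = (real (Suc m) * (p - q - real m)) *\<^sub>R U (Suc m)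
        - (q + real (Suc m)) *\<^sub>R U (Suc m) + (p - real (Suc m)) *\<^sub>R U (Suc m)"
      unfolding Suc.IH 1 2 by (simp add: polar_scale U_def)
    also have "\<dots> = (real (Suc (Suc m)) * (p - q - real (Suc m))) *\<^sub>R U (Suc m)"
      unfolding scaleR_add_left[symmetric] scaleR_diff_left[symmetric]
      by (simp add: algebra_simps)
    finally show ?case .
  qed
qed

text \<open>The power p + 1 would live on words with -1 letters in the first column, so it vanishes.
  Lowering pulls this vanishing down the string as long as (m + 1) (p - q - m) is nonzero, that is,
  for m > p - q.\<close>

lemma polar_raising_nilpotent:
  fixes p q :: nat
  assumes "polar First First F = real p *\<^sub>R F" "polar Second Second F = real q *\<^sub>R F"
    and "polar Second First F = 0" and "q \<le> p"
  shows "(polar First Second ^^ (p - q + 1)) F = 0"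
proof -
  have top: "(polar First Second ^^ Suc p) F = 0"
  proof
    fix w
    define H where "H = (polar First Second ^^ Suc p) F"
    have "polar First First H w = (real p - real (Suc p)) *\<^sub>R H w"
      using polar_raising_power(1)[OF assms(1-3), of "Suc p"] by (simp only: H_def scaleR_fun_apply)
    then have "(real (length (proj First w)) - (real p - real (Suc p))) *\<^sub>R (polar First Second ^^ Suc p) F w = 0"
      unfolding H_def[symmetric] polar_diagonal scaleR_diff_left[of _ "real p - real (Suc p)"] by simp
    moreover have "real (length (proj First w)) - (real p - real (Suc p)) \<noteq> 0"
      by simp
    ultimately show "(polar First Second ^^ Suc p) F w = 0 w"
      by (simp del: funpow.simps)
  qed
  have "p - q + 1 \<le> Suc p" by simp
  then show ?thesis
  proof (induction rule: inc_induct)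
    case base
    show ?case by (rule top)
  next
    case (step m)
    have "(real (Suc m) * (real p - real q - real m)) *\<^sub>R (polar First Second ^^ m) F = 0"
      using polar_raising_power(3)[OF assms(1-3), of m] unfolding step.IH polar_zero by simp
    moreover have "real (Suc m) * (real p - real q - real m) \<noteq> 0"
    proof -
      have "real p < real m + real q"
        using step.hyps \<open>q \<le> p\<close> by linarith
      then show ?thesis by simp
    qed
    ultimately show ?case by simp
  qed
qed

text \<open>Precomposition with \<open>exp (t E\<^sub>i\<^sub>j)\<close>, which substitutes \<open>j + t i\<close> for each letter \<open>j\<close>.\<close>

fun transvect :: "slot \<Rightarrow> slot \<Rightarrow> real \<Rightarrow> ('i word \<Rightarrow> 'a::real_vector) \<Rightarrow> 'i word \<Rightarrow> 'a" where
  "transvect i j t F [] = F []"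
| "transvect i j t F (l # w) = transvect i j t (\<lambda>u. F (l # u)) w
     + (if fst l = j then t *\<^sub>R transvect i j t (\<lambda>u. F ((i, snd l) # u)) w else 0)"

lemma transvect_add_app: "transvect i j t (\<lambda>u. F u + G u) w = transvect i j t F w + transvect i j t G w"
  by (induction w arbitrary: F G) (auto simp: scaleR_add_right)

lemma transvect_scale_app: "transvect i j t (\<lambda>u. c *\<^sub>R F u) w = c *\<^sub>R transvect i j t F w"
  by (induction w arbitrary: F) (auto simp: scaleR_add_right)

lemma transvect_minus_app: "transvect i j t (\<lambda>u. - F u) w = - transvect i j t F w"
  using transvect_scale_app[of i j t "-1" F w] by simp

lemma transvect_diff_app: "transvect i j t (\<lambda>u. F u - G u) w = transvect i j t F w - transvect i j t G w"
  using transvect_add_app[of i j t F "\<lambda>u. - G u" w] by (simp add: transvect_minus_app)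

lemma polar_zero_fun: "polar i j (\<lambda>w. 0) = (\<lambda>w. 0)"
  by (simp add: fun_eq_iff polar_zero_app)

text \<open>Since \<open>i \<noteq> j\<close>, one letter can be replaced at most once, so of the
  binomial expansion only the terms with no hit or one hit on the first letter survive.\<close>

lemma polar_power_Cons:
  assumes "i \<noteq> j" "odd_slot i = odd_slot j"
  shows "(polar i j ^^ n) F (l # w) = (polar i j ^^ n) (\<lambda>u. F (l # u)) w
     + (if fst l = j then real n *\<^sub>R (polar i j ^^ (n - 1)) (\<lambda>u. F ((i, snd l) # u)) w else 0)"
proof (induction n arbitrary: l w)
  case 0
  show ?case by simp
next
  case (Suc n)
  let ?P = "polar i j ^^ n" and ?G = "\<lambda>u. F ((i, snd l) # u)"
  have "(polar i j ^^ Suc n) F (l # w) =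
      (if fst l = j then ?P F ((i, snd l) # w) else 0) + polar i j (\<lambda>u. ?P F (l # u)) w"
    using assms(2) by simp
  also have "\<dots> = (if fst l = j then ?P ?G w else 0)
      + polar i j (?P (\<lambda>u. F (l # u))) w
      + (if fst l = j then real n *\<^sub>R polar i j ((polar i j ^^ (n - 1)) ?G) w else 0)"
    unfolding Suc.IH polar_add_app polar_if_app polar_scale_app using assms(1) by simp
  also have "\<dots> = (polar i j ^^ Suc n) (\<lambda>u. F (l # u)) w
      + (if fst l = j then real (Suc n) *\<^sub>R (polar i j ^^ (Suc n - 1)) ?G w else 0)"
    by (cases n) (simp_all add: scaleR_add_left scaleR_2)
  finally show ?case .
qed

text \<open>A word admits at most as many replacements as it has letters, so the exponential series
  truncated at any \<open>N\<close> not below the length is exact.\<close>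

lemma transvect_series:
  assumes "i \<noteq> j" "odd_slot i = odd_slot j" "length w \<le> N"
  shows "transvect i j t F w = (\<Sum>n\<le>N. (t ^ n / fact n) *\<^sub>R (polar i j ^^ n) F w)"
  using assms(3)
proof (induction w arbitrary: F N)
  case Nil
  have "(polar i j ^^ n) F [] = 0" if "n > 0" for n
    using that by (cases n) auto
  then have "(\<Sum>n\<le>N. (t ^ n / fact n) *\<^sub>R (polar i j ^^ n) F []) = (\<Sum>n\<in>{0}. (t ^ n / fact n) *\<^sub>R (polar i j ^^ n) F [])"
    by (intro sum.mono_neutral_right) auto
  then show ?case by simp
next
  case (Cons l w)
  then obtain M where N: "N = Suc M" "length w \<le> M" by (cases N) auto
  let ?G = "\<lambda>u. F ((i, snd l) # u)"
  have "(\<Sum>n\<le>N. (t ^ n / fact n) *\<^sub>R (real n *\<^sub>R (polar i j ^^ (n - 1)) ?G w))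
      = t *\<^sub>R (\<Sum>n\<le>M. (t ^ n / fact n) *\<^sub>R (polar i j ^^ n) ?G w)"
    unfolding N sum.atMost_Suc_shift scaleR_sum_right
    by (simp add: field_simps del: of_nat_Suc)
  moreover have "(\<Sum>n\<le>N. (t ^ n / fact n) *\<^sub>R (polar i j ^^ n) F (l # w))
      = (\<Sum>n\<le>N. (t ^ n / fact n) *\<^sub>R (polar i j ^^ n) (\<lambda>u. F (l # u)) w)
      + (if fst l = j then (\<Sum>n\<le>N. (t ^ n / fact n) *\<^sub>R (real n *\<^sub>R (polar i j ^^ (n - 1)) ?G w)) else 0)"
    unfolding polar_power_Cons[OF assms(1,2)] scaleR_add_right sum.distrib by simp
  ultimately show ?case
    using Cons.IH[of N "\<lambda>u. F (l # u)"] Cons.IH[OF N(2), of ?G] Cons.prems by simp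
qed

lemma transvect_nilpotent2:
  assumes "i \<noteq> j" "odd_slot i = odd_slot j" "polar i j (polar i j F) = 0"
  shows "transvect i j t F = F + t *\<^sub>R polar i j F"
proof
  fix w
  have "(polar i j ^^ (m + 2)) F = 0" for m
    by (induction m) (simp_all add: assms(3) polar_zero_fun)
  then have zero: "(polar i j ^^ n) F = 0" if "2 \<le> n" for n
    using le_Suc_ex[OF that] by (metis add.commute)
  have "transvect i j t F w = (\<Sum>n\<le>length w + 1. (t ^ n / fact n) *\<^sub>R (polar i j ^^ n) F w)"
    by (rule transvect_series[OF assms(1,2)]) simp
  also have "\<dots> = (\<Sum>n\<in>{0,1}. (t ^ n / fact n) *\<^sub>R (polar i j ^^ n) F w)"
    by (rule sum.mono_neutral_right) (auto simp: zero)
  finally show "transvect i j t F w = (F + t *\<^sub>R polar i j F) w" by simp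
qed

section \<open>Exchange of the two columns\<close>

fun swap_slot :: "slot \<Rightarrow> slot" where
  "swap_slot First = Second"
| "swap_slot Second = First"
| "swap_slot Deriv = Deriv"

definition swap_word :: "'i word \<Rightarrow> 'i word" where
  "swap_word = map (map_prod swap_slot id)"

lemma swap_word_simps [simp]:
  "swap_word [] = []" "swap_word (l # w) = (swap_slot (fst l), snd l) # swap_word w"
  "swap_word (u @ w) = swap_word u @ swap_word w"
  by (auto simp: swap_word_def map_prod_def split: prod.split)

lemma proj_swap_word [simp]: "proj c (swap_word w) = proj (swap_slot c) w"
proof (induction w)
  case (Cons l w)
  then show ?case by (cases "fst l"; cases c) auto
qed simp

text \<open>The Weyl element of \<open>sl\<^sub>2\<close> as a product of three transvections.\<close>

lemma transvect_weyl:
  "transvect First Second 1 (transvect Second First (-1) (transvect First Second 1 F)) w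
     = (-1) ^ length (proj First w) *\<^sub>R F (swap_word w)"
proof (induction w arbitrary: F)
  case (Cons l w)
  obtain c x where "l = (c, x)" by (cases l)
  then show ?case
    by (cases c)
       (simp_all add: transvect_add_app transvect_minus_app transvect_diff_app Cons.IH cong: if_cong)
qed simp

text \<open>With weights q + 1 and q, \<open>F\<close> and \<open>polar First Second F\<close> form
  a doublet. The three transvections carry \<open>F\<close> to \<open>F + ?U F\<close>, then to
  \<open>?U F\<close>, which the last one fixes; by \<open>transvect_weyl\<close> their product is
  the column swap up to sign.\<close>

lemma swap_doublet:
  assumes "polar First First F = real (Suc q) *\<^sub>R F" "polar Second Second F = real q *\<^sub>R F"
    and "polar Second First F = 0"
  shows "polar First Second F w = (-1) ^ q *\<^sub>R F (swap_word w)"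
proof -
  let ?U = "polar First Second" and ?V = "polar Second First"
  have UU: "?U (?U F) = 0"
    using polar_raising_nilpotent[OF assms] by (simp add: numeral_2_eq_2)
  have VU: "?V (?U F) = F"
    using polar_raising_power(3)[OF assms, of 0] by simp
  have 1: "transvect First Second 1 F = F + ?U F"
    using transvect_nilpotent2[of First Second F 1] UU by (simp add: odd_slot_def)
  have "?V (F + ?U F) = F"
    by (simp add: polar_add VU assms)
  then have 2: "transvect Second First (-1) (F + ?U F) = ?U F"
    using transvect_nilpotent2[of Second First "F + ?U F" "-1"] assms(3) by (simp add: odd_slot_def)
  have 3: "transvect First Second 1 (?U F) = ?U F"
    using transvect_nilpotent2[of First Second "?U F" 1] UU by (simp add: odd_slot_def polar_zero)
  have eq: "?U F w = (-1) ^ length (proj First w) *\<^sub>R F (swap_word w)"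
    using transvect_weyl[of F w] unfolding 1 2 3 .
  show ?thesis
  proof (cases "length (proj First w) = q")
    case True
    then show ?thesis using eq by simp
  next
    \<comment> \<open>Off the weight of \<open>F\<close> both sides vanish, so the sign may be
      written with the constant \<open>q\<close>.\<close>
    case False
    then have "F (swap_word w) = 0"
      by (intro weight_support[OF assms(2)]) simp
    then show ?thesis using eq by simp
  qed
qed

section \<open>Supersymmetric functions of words\<close>

definition supersym :: "('i word \<Rightarrow> 'a::real_vector) \<Rightarrow> bool" where
  "supersym F \<longleftrightarrow> (\<forall>u a b v. F (u @ a # b # v) =
     koszul (odd_slot (fst a)) (odd_slot (fst b)) *\<^sub>R F (u @ b # a # v))"

lemma supersymD:
  "supersym F \<Longrightarrow> F (u @ a # b # v) = koszul (odd_slot (fst a)) (odd_slot (fst b)) *\<^sub>R F (u @ b # a # v)"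
  unfolding supersym_def by blast

lemma supersymI:
  "(\<And>u a b v. F (u @ a # b # v) = koszul (odd_slot (fst a)) (odd_slot (fst b)) *\<^sub>R F (u @ b # a # v))
    \<Longrightarrow> supersym F"
  unfolding supersym_def by blast

lemma supersym_append:
  assumes "supersym F"
  shows "supersym (\<lambda>u. F (z @ u))"
proof (rule supersymI)
  show "F (z @ u @ a # b # v) = koszul (odd_slot (fst a)) (odd_slot (fst b)) *\<^sub>R F (z @ u @ b # a # v)"
    for u a b v
    using supersymD[OF assms, of "z @ u" a b v] by simp
qed

lemma supersym_Cons: "supersym F \<Longrightarrow> supersym (\<lambda>u. F (l # u))"
  using supersym_append[of F "[l]"] by simp

lemma supersym_add:
  assumes "supersym F" "supersym G"
  shows "supersym (F + G)"
proof (rule supersymI)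
  show "(F + G) (u @ a # b # v) =
      koszul (odd_slot (fst a)) (odd_slot (fst b)) *\<^sub>R (F + G) (u @ b # a # v)" for u a b v
    using supersymD[OF assms(1), of u a b v] supersymD[OF assms(2), of u a b v]
    by (simp add: scaleR_add_right)
qed

lemma supersym_scale:
  assumes "supersym F"
  shows "supersym (c *\<^sub>R F)"
proof (rule supersymI)
  show "(c *\<^sub>R F) (u @ a # b # v) =
      koszul (odd_slot (fst a)) (odd_slot (fst b)) *\<^sub>R (c *\<^sub>R F) (u @ b # a # v)" for u a b v
    using supersymD[OF assms, of u a b v] by simp
qed

lemma supersym_diff: "supersym F \<Longrightarrow> supersym G \<Longrightarrow> supersym (F - G)"
  using supersym_add[of F "- 1 *\<^sub>R G"] supersym_scale[of G "- 1"] by simp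

text \<open>Only an exchange at the front of the word needs a check of letter kinds; deeper ones
  reduce to it by peeling off letters.\<close>

lemma supersym_polar:
  assumes "supersym F"
  shows "supersym (polar i j F)"
proof (rule supersymI)
  fix u a b v
  show "polar i j F (u @ a # b # v) =
      koszul (odd_slot (fst a)) (odd_slot (fst b)) *\<^sub>R polar i j F (u @ b # a # v)"
    using assms
  proof (induction u arbitrary: F)
    case Nil
    have *: "F (a' # b' # w) = koszul (odd_slot (fst a')) (odd_slot (fst b')) *\<^sub>R F (b' # a' # w)" for a' b' w
      using supersymD[OF Nil, of "[]" a' b' w] by simp
    have **: "polar i j (\<lambda>u. F (a # b # u)) v =
        koszul (odd_slot (fst a)) (odd_slot (fst b)) *\<^sub>R polar i j (\<lambda>u. F (b # a # u)) v"
      unfolding *[of a b] by (rule polar_scale_app)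
    obtain c x d y where ab: "a = (c, x)" "b = (d, y)" by (cases a; cases b)
    show ?case
      unfolding polar.simps append_Nil **
      using *[of "(i, x)" b v] *[of a "(i, y)" v]
      by (cases i; cases j; cases c; cases d) (simp_all add: ab odd_slot_def koszul_def)
  next
    case (Cons l u)
    have "supersym (\<lambda>u. F (l # u))"
      by (rule supersym_Cons[OF Cons.prems])
    from Cons.IH[OF this] show ?case
      using supersymD[OF Cons.prems, of "(i, snd l) # u" a b v]
      by (simp add: scaleR_add_right)
  qed
qed

lemma supersym_grad: "supersym F \<Longrightarrow> supersym (grad r F)"
  unfolding grad_def by (intro supersym_diff supersym_scale supersym_polar)

lemma supersym_move:
  assumes "supersym F"
  shows "F (a # map (Pair c) xs @ v) =
    koszul (odd_slot (fst a)) (odd_slot c) ^ length xs *\<^sub>R F (map (Pair c) xs @ a # v)"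
  using assms
proof (induction xs arbitrary: F)
  case (Cons x xs)
  have "F (a # map (Pair c) (x # xs) @ v) =
      koszul (odd_slot (fst a)) (odd_slot c) *\<^sub>R F ((c, x) # a # map (Pair c) xs @ v)"
    using supersymD[OF Cons.prems, of "[]" a "(c, x)" "map (Pair c) xs @ v"] by simp
  also have "F ((c, x) # a # map (Pair c) xs @ v) =
      koszul (odd_slot (fst a)) (odd_slot c) ^ length xs *\<^sub>R F ((c, x) # map (Pair c) xs @ a # v)"
    by (rule Cons.IH[OF supersym_Cons[OF Cons.prems]])
  finally show ?case by simp
qed simp

lemma supersym_permute_even:
  assumes "supersym F" "mset xs = mset ys"
  shows "F (u @ map (Pair Deriv) xs @ v) = F (u @ map (Pair Deriv) ys @ v)"
  using assms
proof (induction xs arbitrary: u ys)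
  case (Cons x xs)
  then have "x \<in> set ys" by (metis list.set_intros(1) set_mset_mset)
  then obtain ys1 ys2 where ys: "ys = ys1 @ x # ys2" by (meson split_list)
  have "F (u @ map (Pair Deriv) (x # xs) @ v) = F ((u @ [(Deriv, x)]) @ map (Pair Deriv) xs @ v)"
    by simp
  also have "\<dots> = F ((u @ [(Deriv, x)]) @ map (Pair Deriv) (ys1 @ ys2) @ v)"
    by (rule Cons.IH) (use Cons.prems ys in auto)
  also have "\<dots> = F (u @ map (Pair Deriv) ys @ v)"
    using supersym_move[OF supersym_append[OF Cons.prems(1), of u], of "(Deriv, x)" Deriv ys1 "map (Pair Deriv) ys2 @ v"]
    by (simp add: ys odd_slot_def)
  finally show ?case .
qed simp

lemma supersym_swap_odd_blocks:
  assumes "supersym F" "odd_slot c" "odd_slot d"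
  shows "F (map (Pair c) xs @ map (Pair d) ys @ v) =
    (-1) ^ (length xs * length ys) *\<^sub>R F (map (Pair d) ys @ map (Pair c) xs @ v)"
  using assms(1)
proof (induction xs arbitrary: F)
  case (Cons x xs)
  have "F (map (Pair c) (x # xs) @ map (Pair d) ys @ v) =
      (-1) ^ (length xs * length ys) *\<^sub>R F ((c, x) # map (Pair d) ys @ map (Pair c) xs @ v)"
    using Cons.IH[OF supersym_Cons[OF Cons.prems]] by simp
  also have "F ((c, x) # map (Pair d) ys @ map (Pair c) xs @ v) =
      (-1) ^ length ys *\<^sub>R F (map (Pair d) ys @ (c, x) # map (Pair c) xs @ v)"
    using supersym_move[OF Cons.prems] assms(2,3) by simp
  finally show ?case by (simp add: power_add mult.commute)
qed simp

lemma supersym_transpose: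
  assumes "supersym F" "odd_slot c"
  shows "F (u @ (c, a) # map (Pair c) v @ (c, b) # z) = - F (u @ (c, b) # map (Pair c) v @ (c, a) # z)"
proof -
  let ?G = "\<lambda>w. F (u @ w)"
  have G: "supersym ?G" by (rule supersym_append[OF assms(1)])
  have 1: "?G ((c, y) # map (Pair c) v @ w) = (-1) ^ length v *\<^sub>R ?G (map (Pair c) v @ (c, y) # w)" for y w
    using supersym_move[OF G, of "(c, y)"] assms(2) by simp
  have 2: "?G (map (Pair c) v @ (c, a) # (c, b) # z) = - ?G (map (Pair c) v @ (c, b) # (c, a) # z)"
    using supersymD[OF G, of "map (Pair c) v" "(c, a)" "(c, b)" z] assms(2) by simp
  show ?thesis using 1 2 by simp
qed

definition normal_word :: "'i list \<Rightarrow> 'i list \<Rightarrow> 'i list \<Rightarrow> 'i word" where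
  "normal_word xs ys ds = map (Pair First) xs @ map (Pair Second) ys @ map (Pair Deriv) ds"

lemma proj_normal_word [simp]:
  "proj First (normal_word xs ys ds) = xs"
  "proj Second (normal_word xs ys ds) = ys"
  "proj Deriv (normal_word xs ys ds) = ds"
  by (simp_all add: normal_word_def)

text \<open>The sign picked up when all \<open>First\<close> letters are moved in front of the \<open>Second\<close> letters.\<close>

fun inv_sign :: "'i word \<Rightarrow> real" where
  "inv_sign [] = 1"
| "inv_sign (l # w) = (if fst l = Second then (-1) ^ length (proj First w) else 1) * inv_sign w"

lemma supersym_normal:
  assumes "supersym F"
  shows "F w = inv_sign w *\<^sub>R F (normal_word (proj First w) (proj Second w) (proj Deriv w))"
  using assms
proof (induction w arbitrary: F)
  case Nil
  show ?case by (simp add: normal_word_def)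
next
  case (Cons l w)
  obtain c x where l: "l = (c, x)" by (cases l)
  let ?xs = "proj First w" and ?ys = "proj Second w" and ?ds = "proj Deriv w"
  have "F (l # w) = inv_sign w *\<^sub>R F (l # normal_word ?xs ?ys ?ds)"
    by (rule Cons.IH[OF supersym_Cons[OF Cons.prems]])
  also have "F (l # normal_word ?xs ?ys ?ds) = (if c = Second then (-1) ^ length ?xs else 1) *\<^sub>R
      F (normal_word (proj First (l # w)) (proj Second (l # w)) (proj Deriv (l # w)))"
  proof (cases c)
    case First
    then show ?thesis by (simp add: l normal_word_def)
  next
    case Second
    then show ?thesis
      using supersym_move[OF Cons.prems, of l First ?xs] by (simp add: l normal_word_def odd_slot_def)
  next
    case Deriv
    then show ?thesis
      using supersym_move[OF Cons.prems, of l First ?xs]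
        supersym_move[OF supersym_append[OF Cons.prems, of "map (Pair First) ?xs"], of l Second ?ys]
      by (simp add: l normal_word_def odd_slot_def)
  qed
  finally show ?case by (simp add: l)
qed

lemma supersym_normal_mset:
  assumes "supersym F" "mset ds = mset (proj Deriv w)"
  shows "F w = inv_sign w *\<^sub>R F (normal_word (proj First w) (proj Second w) ds)"
  using supersym_normal[OF assms(1), of w]
    supersym_permute_even[OF assms(1) assms(2), of "map (Pair First) (proj First w) @ map (Pair Second) (proj Second w)" "[]"]
  by (simp add: normal_word_def)

lemma inv_sign_append:
  "inv_sign (u @ v) = inv_sign u * inv_sign v * (-1) ^ (length (proj Second u) * length (proj First v))"
  by (induction u) (auto simp: power_add)

lemma inv_sign_map_Pair [simp]: "inv_sign (map (Pair c) xs) = 1"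
  by (induction xs) auto

lemma inv_sign_normal_word [simp]: "inv_sign (normal_word xs ys ds) = 1"
  by (simp add: normal_word_def inv_sign_append)

section \<open>Polarizations evaluated block by block, and the Young relation\<close>

lemma polar_block_other:
  assumes "c \<noteq> j"
  shows "polar i j F (map (Pair c) xs @ z) =
    koszul (odd_slot i \<noteq> odd_slot j) (odd_slot c) ^ length xs *\<^sub>R polar i j (\<lambda>u. F (map (Pair c) xs @ u)) z"
  using assms by (induction xs arbitrary: F) auto

lemma polar_block_same:
  "polar i j F (map (Pair j) xs @ z) =
    (\<Sum>m<length xs. koszul (odd_slot i \<noteq> odd_slot j) (odd_slot j) ^ m *\<^sub>R
      F (map (Pair j) (take m xs) @ (i, xs ! m) # map (Pair j) (drop (Suc m) xs) @ z))
    + koszul (odd_slot i \<noteq> odd_slot j) (odd_slot j) ^ length xs *\<^sub>R polar i j (\<lambda>u. F (map (Pair j) xs @ u)) z"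
proof (induction xs arbitrary: F)
  case (Cons x xs)
  show ?case
    by (simp add: Cons.IH sum.lessThan_Suc_shift scaleR_add_right scaleR_sum_right del: sum.lessThan_Suc)
qed simp

lemma polar_absent: "proj j w = [] \<Longrightarrow> polar i j F w = 0"
  by (induction w arbitrary: F) (auto split: if_splits)

text \<open>The letter \<open>ys ! j\<close>, put into the first column at its place, is turned back by one term of \<open>E\<^sub>2\<^sub>1\<close>;
  in the other terms some \<open>xs ! i\<close> is exchanged with it.\<close>

lemma polar_young:
  assumes "supersym F" "j < length ys"
  shows "polar Second First F (map (Pair First) xs @
      map (Pair Second) (take j ys) @ (First, ys ! j) # map (Pair Second) (drop (Suc j) ys) @ map (Pair Deriv) ds)
    = F (normal_word xs ys ds) - (\<Sum>i<length xs. F (normal_word (xs[i := ys ! j]) (ys[j := xs ! i]) ds))"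
proof -
  let ?A = "map (Pair Second) (take j ys)" and ?B = "map (Pair Second) (drop (Suc j) ys) @ map (Pair Deriv) ds"
  have "polar Second First F (map (Pair First) xs @ ?A @ (First, ys ! j) # ?B) =
      (\<Sum>i<length xs. F (map (Pair First) (take i xs) @ (Second, xs ! i) # map (Pair First) (drop (Suc i) xs) @ ?A @ (First, ys ! j) # ?B))
      + F (map (Pair First) xs @ ?A @ (Second, ys ! j) # ?B)"
    by (simp add: polar_block_same polar_block_other polar_absent odd_slot_def)
  moreover have "F (map (Pair First) xs @ ?A @ (Second, ys ! j) # ?B) = F (normal_word xs ys ds)"
    unfolding normal_word_def using id_take_nth_drop[OF assms(2)]
    by (metis append.assoc append_Cons list.simps(9) map_append)
  moreover have "F (map (Pair First) (take i xs) @ (Second, xs ! i) # map (Pair First) (drop (Suc i) xs) @ ?A @ (First, ys ! j) # ?B)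
      = - F (normal_word (xs[i := ys ! j]) (ys[j := xs ! i]) ds)" if i: "i < length xs" for i
  proof -
    let ?G = "\<lambda>w. F (map (Pair First) (take i xs) @ w)"
    let ?xs = "drop (Suc i) xs"
    have G: "supersym ?G" by (rule supersym_append[OF assms(1)])
    have G': "supersym (\<lambda>w. ?G (map (Pair First) ?xs @ w))" by (rule supersym_append[OF G])
    have move: "?G (a # map (Pair First) ?xs @ ?A @ z) =
        koszul (odd_slot (fst a)) True ^ (length ?xs + length (take j ys)) *\<^sub>R ?G (map (Pair First) ?xs @ ?A @ a # z)" for a z
      using supersym_move[OF G, of a First ?xs "?A @ z"] supersym_move[OF G', of a Second "take j ys" z]
      by (simp add: odd_slot_def power_add)
    have "?G ((Second, xs ! i) # map (Pair First) ?xs @ ?A @ (First, ys ! j) # ?B)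
        = - ?G ((First, ys ! j) # map (Pair First) ?xs @ ?A @ (Second, xs ! i) # ?B)"
      using supersymD[OF G, of "map (Pair First) ?xs @ ?A" "(Second, xs ! i)" "(First, ys ! j)" ?B]
      unfolding move by (simp add: odd_slot_def)
    then show ?thesis
      using i assms(2) by (simp add: normal_word_def upd_conv_take_nth_drop)
  qed
  ultimately show ?thesis by (simp add: sum_negf)
qed

text \<open>A converse to \<open>polar_young\<close>. The relation for the first index of the second
  column suffices, because the last letter of the first column in a normal word plays the role of
  that index.\<close>

lemma supersym_young_vanishes:
  assumes F: "supersym F"
    and young: "\<And>xs y ys ds. F (normal_word xs (y # ys) ds) =
      (\<Sum>i<length xs. F (normal_word (xs[i := y]) (xs ! i # ys) ds))"
  shows "polar Second First F = 0"
proof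
  fix w
  let ?V = "polar Second First F"
  have "?V (normal_word X Y Z) = 0" for X Y Z
  proof (cases X rule: rev_cases)
    case Nil
    then show ?thesis by (intro polar_absent) simp
  next
    case (snoc xs y)
    then show ?thesis
      using polar_young[OF F, of 0 "y # Y" xs Z] young[of xs y Y Z] by (simp add: normal_word_def)
  qed
  then show "?V w = 0 w"
    using supersym_normal[OF supersym_polar[OF F], of Second First w] by simp
qed

lemma permute_list_transpose:
  assumes "a < b" "b < length xs"
  shows "permute_list (transpose a b) xs =
      take a xs @ xs ! b # drop (Suc a) (take b xs) @ xs ! a # drop (Suc b) xs"
    and "xs = take a xs @ xs ! a # drop (Suc a) (take b xs) @ xs ! b # drop (Suc b) xs"
proof -
  define A B C where "A = take a xs" and "B = drop (Suc a) (take b xs)" and "C = drop (Suc b) xs"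
  have len: "length A = a" "length B = b - Suc a"
    using assms by (auto simp: A_def B_def)
  have "take b xs = A @ xs ! a # B"
    using id_take_nth_drop[of a "take b xs"] assms by (simp add: A_def B_def min_def)
  then show xs: "xs = take a xs @ xs ! a # drop (Suc a) (take b xs) @ xs ! b # drop (Suc b) xs"
    using id_take_nth_drop[OF assms(2)] unfolding A_def B_def by (metis append.assoc append_Cons)
  have "permute_list (transpose a b) xs = xs[a := xs ! b, b := xs ! a]"
    using assms by (intro nth_equalityI) (auto simp: permute_list_def nth_list_update transpose_def)
  also have "\<dots> = (A @ xs ! a # B @ xs ! b # C)[a := xs ! b, b := xs ! a]"
    using xs unfolding A_def B_def C_def by simp
  also have "\<dots> = A @ xs ! b # B @ xs ! a # C"
    using assms len by (simp add: list_update_append Suc_diff_Suc[symmetric])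
  finally show "permute_list (transpose a b) xs =
      take a xs @ xs ! b # drop (Suc a) (take b xs) @ xs ! a # drop (Suc b) xs"
    unfolding A_def B_def C_def .
qed

text \<open>Permutations are built from transpositions, and exchanging two odd letters across a
  block of the same kind costs exactly one sign.\<close>

lemma supersym_permute_odd:
  assumes "supersym F" "odd_slot c" "\<sigma> permutes {..<length xs}"
  shows "F (u @ map (Pair c) (permute_list \<sigma> xs) @ v) = of_int (sign \<sigma>) *\<^sub>R F (u @ map (Pair c) xs @ v)"
proof -
  have trans: "F (u @ map (Pair c) (permute_list (transpose a b) ys) @ v) = - F (u @ map (Pair c) ys @ v)"
    if "a < b" "b < length ys" for a b ys
  proof -
    let ?A = "u @ map (Pair c) (take a ys)" and ?B = "map (Pair c) (drop (Suc a) (take b ys))"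
      and ?C = "map (Pair c) (drop (Suc b) ys) @ v"
    have "F (?A @ (c, ys ! b) # ?B @ (c, ys ! a) # ?C) = - F (?A @ (c, ys ! a) # ?B @ (c, ys ! b) # ?C)"
      by (rule supersym_transpose[OF assms(1,2)])
    moreover have "u @ map (Pair c) ys @ v = ?A @ (c, ys ! a) # ?B @ (c, ys ! b) # ?C"
      by (subst permute_list_transpose(2)[OF that]) simp
    ultimately show ?thesis
      by (simp add: permute_list_transpose(1)[OF that])
  qed
  have "finite {..<length xs}" by simp
  then show ?thesis using assms(3)
  proof (induction rule: permutes_rev_induct)
    case id
    then show ?case by simp
  next
    case (swap a b p)
    have t: "transpose a b permutes {..<length xs}"
      using swap by (intro permutes_swap_id) auto
    have "F (u @ map (Pair c) (permute_list (p \<circ> transpose a b) xs) @ v)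
        = - F (u @ map (Pair c) (permute_list p xs) @ v)"
      unfolding permute_list_compose[OF t]
      using trans[of a b "permute_list p xs"] trans[of b a "permute_list p xs"] swap
      by (cases a b rule: linorder_cases) (auto simp: transpose_commute)
    moreover have "sign (p \<circ> transpose a b) = - sign p"
      using swap by (subst sign_compose) (auto simp: sign_swap_id permutation_swap_id permutes_imp_permutation[OF finite_lessThan])
    ultimately show ?case
      by (simp only: swap.IH of_int_minus scaleR_minus_left)
  qed
qed

section \<open>Locality of polarizations and restriction to a fixed number of derivatives\<close>

lemma polar_cong:
  assumes "\<And>u x v. w = u @ (j, x) # v \<Longrightarrow> F (u @ (i, x) # v) = G (u @ (i, x) # v)"
  shows "polar i j F w = polar i j G w"
  using assms
proof (induction w arbitrary: F G)
  case (Cons l w)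
  have "polar i j (\<lambda>u. F (l # u)) w = polar i j (\<lambda>u. G (l # u)) w"
    by (rule Cons.IH) (use Cons.prems[of "l # _"] in auto)
  moreover have "fst l = j \<Longrightarrow> F ((i, snd l) # w) = G ((i, snd l) # w)"
    using Cons.prems[of "[]" "snd l" w] by (cases l) auto
  ultimately show ?case by simp
qed simp

lemma polar_eq_0:
  assumes "\<And>u x v. w = u @ (j, x) # v \<Longrightarrow> F (u @ (i, x) # v) = 0"
  shows "polar i j F w = 0"
  using polar_cong[of w j F i "\<lambda>_. 0"] assms by (simp add: polar_zero_app)

lemma polar_swap_word:
  "polar i j F (swap_word w) = polar (swap_slot i) (swap_slot j) (\<lambda>u. F (swap_word u)) w"
proof (induction w arbitrary: F)
  case (Cons l w)
  obtain c x where l: "l = (c, x)" by (cases l)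
  have invol: "swap_slot (swap_slot s) = s" for s by (cases s) auto
  have odd: "odd_slot (swap_slot s) = odd_slot s" for s by (cases s) (auto simp: odd_slot_def)
  have "(swap_slot c = j) = (c = swap_slot j)" by (metis invol)
  then show ?case
    by (simp add: l Cons.IH invol odd)
qed simp

text \<open>The generators of one kind form a single function on words of all derivative orders; on
  one order \<open>polar Deriv Deriv\<close> becomes a scalar.\<close>

definition at_order :: "nat \<Rightarrow> ('i word \<Rightarrow> 'a::real_vector) \<Rightarrow> 'i word \<Rightarrow> 'a" where
  "at_order n F w = (if length (proj Deriv w) = n then F w else 0)"

text \<open>The index shifts against intuition because of the precomposition: at a given word,
  \<open>polar Deriv i F\<close> evaluates \<open>F\<close> on words with one more
  derivative.\<close>

lemma polar_at_order:
  assumes "i \<noteq> Deriv"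
  shows "polar Deriv i (at_order (Suc n) F) = at_order n (polar Deriv i F)"
    and "polar i Deriv (at_order n F) = at_order (Suc n) (polar i Deriv F)"
proof -
  show "polar Deriv i (at_order (Suc n) F) = at_order n (polar Deriv i F)"
    unfolding at_order_def using assms
    by (intro ext) (auto intro!: polar_cong polar_eq_0)
  show "polar i Deriv (at_order n F) = at_order (Suc n) (polar i Deriv F)"
    unfolding at_order_def using assms
    by (intro ext) (auto intro!: polar_cong polar_eq_0)
qed

lemma polar_at_order_inner:
  assumes "i \<noteq> Deriv" "j \<noteq> Deriv"
  shows "polar i j (at_order n F) = at_order n (polar i j F)"
  unfolding at_order_def using assms
  by (intro ext) (auto intro!: polar_cong polar_eq_0)

lemma casimir_at_order: "casimir (at_order n F) = at_order n (casimir F)"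
  by (auto simp: casimir_def polar_at_order at_order_def fun_eq_iff)

lemma at_order_scale: "at_order n (c *\<^sub>R F) = c *\<^sub>R at_order n F"
  by (auto simp: at_order_def fun_eq_iff)

locale young_symmetric =
  fixes F :: "'i word \<Rightarrow> 'a::real_vector" and p q :: nat
  assumes sym: "supersym F"
    and weight_First: "polar First First F = real p *\<^sub>R F"
    and weight_Second: "polar Second Second F = real q *\<^sub>R F"
    and young: "polar Second First F = 0"
    and le: "q \<le> p"
begin

lemma highest_weight_at_order: "highest_weight (at_order n F) (real p) (real q) (real n)"
proof
  show "polar Deriv Deriv (at_order n F) = real n *\<^sub>R at_order n F"
    by (auto simp: fun_eq_iff polar_diagonal at_order_def)
  show "polar Second First (at_order n F) = 0"
    by (auto simp: polar_at_order_inner young fun_eq_iff at_order_def)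
qed (simp_all add: polar_at_order_inner weight_First weight_Second at_order_scale)

text \<open>Normal ordering reduces the anticommutator of \<open>grad\<close> and
  \<open>polar Second Deriv\<close> to a scalar and \<open>casimir\<close>. The parameter of the
  second \<open>grad\<close> is larger by one because \<open>polar Second Deriv\<close> lowers the
  weight of the second column by one.\<close>

lemma laplacian_app:
  "(polar Second Deriv (grad (real p - real q) F) + grad (real p - real q + 1) (polar Second Deriv F)) w =
    - (((real p - real q) * (real q + real (length (proj Deriv w)) - 1)) *\<^sub>R F w + casimir F w)"
proof -
  have "polar Second Deriv (grad (real p - real q) F) + grad (real p - real q + 1) (polar Second Deriv F)
      = - ((real p - real q) *\<^sub>R ((real q - 1) *\<^sub>R F + polar Deriv Deriv F) + casimir F)"
    by (simp add: grad_def casimir_def polar_normal_order polar_linear weight_First weight_Second young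
        polar_weight algebra_simps)
  then show ?thesis
    by (simp only:) (simp add: polar_diagonal algebra_simps)
qed

text \<open>On words without derivatives the products in the opposite order vanish, so the
  anticommutators leave only the weights \<open>p\<close> and \<open>q\<close>.\<close>

lemma casimir_order_0: "casimir (at_order 0 F) = (real p + real q) *\<^sub>R at_order 0 F"
proof -
  interpret highest_weight "at_order 0 F" "real p" "real q" "real 0"
    by (rule highest_weight_at_order)
  have 0: "polar Deriv i (at_order 0 F) = 0" for i
    by (rule ext) (auto simp: at_order_def intro!: polar_eq_0)
  have "polar First Deriv (polar Deriv First (at_order 0 F)) = 0"
    "polar Second Deriv (polar Deriv Second (at_order 0 F)) = 0"
    by (simp_all only: 0 polar_zero)
  then show ?thesis
    by (simp add: casimir_def hw scaleR_add_left eq_neg_iff_add_eq_0 add_eq_0_iff)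
qed

lemma raising_eq_0: "p = q \<Longrightarrow> polar First Second F = 0"
  using polar_raising_nilpotent[OF weight_First weight_Second young le] by simp

end

section \<open>The algebra of local functions\<close>

definition lf_fam_eq :: "(nat \<Rightarrow> nat \<Rightarrow> lf) \<Rightarrow> (nat \<Rightarrow> nat \<Rightarrow> lf) \<Rightarrow> bool" where
  "lf_fam_eq f g \<longleftrightarrow> (\<forall>k D. lf_eq k D (f k D) (g k D))"

lemma equivp_lf_fam_eq: "equivp lf_fam_eq"
proof (rule equivpI)
  show "reflp lf_fam_eq" "symp lf_fam_eq"
    by (auto simp: reflp_def symp_def lf_fam_eq_def intro: lf_eq.refl lf_eq.sym)
  show "transp lf_fam_eq"
    unfolding transp_def lf_fam_eq_def using lf_eq.trans by blast
qed

text \<open>A type cannot depend on the parameters \<open>k\<close> and \<open>D\<close> of \<open>lf_eq\<close>, so the quotient is taken for all of them at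
  once; \<open>cls k D\<close> below embeds the algebra of one pair.\<close>

quotient_type locfun = "nat \<Rightarrow> nat \<Rightarrow> lf" / lf_fam_eq
  by (rule equivp_lf_fam_eq)

declare lf_eq.trans [trans]

lemma lf_zero_mul: "lf_eq k D (Mul (Cst 0) a) (Cst 0)"
proof -
  have "lf_eq k D (Mul (Cst 0) a) (Mul (Add (Cst 1) (Cst (-1))) a)"
    using lf_eq.sym[OF cst_add[of k D 1 "-1"]] by (intro mul_cong lf_eq.refl) simp
  also have "lf_eq k D (Mul (Add (Cst 1) (Cst (-1))) a) (Add (Mul (Cst 1) a) (Mul (Cst (-1)) a))"
    by (rule distrib_r)
  also have "lf_eq k D (Add (Mul (Cst 1) a) (Mul (Cst (-1)) a)) (Add a (Mul (Cst (-1)) a))"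
    by (intro add_cong mul_one_l lf_eq.refl)
  also have "lf_eq k D (Add a (Mul (Cst (-1)) a)) (Cst 0)"
    by (rule add_neg)
  finally show ?thesis .
qed

lemma lf_Cst_mul_zero: "lf_eq k D (Mul (Cst c) (Cst 0)) (Cst 0)"
  using cst_mul[of k D c 0] by simp

instantiation locfun :: real_algebra
begin

lift_definition zero_locfun :: locfun is "\<lambda>_ _. Cst 0" .
lift_definition plus_locfun :: "locfun \<Rightarrow> locfun \<Rightarrow> locfun" is "\<lambda>f g k D. Add (f k D) (g k D)"
  by (auto simp: lf_fam_eq_def intro: add_cong)
lift_definition times_locfun :: "locfun \<Rightarrow> locfun \<Rightarrow> locfun" is "\<lambda>f g k D. Mul (f k D) (g k D)"
  by (auto simp: lf_fam_eq_def intro: mul_cong)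
lift_definition scaleR_locfun :: "real \<Rightarrow> locfun \<Rightarrow> locfun" is "\<lambda>c f k D. Mul (Cst c) (f k D)"
  by (auto simp: lf_fam_eq_def intro: mul_cong lf_eq.refl)
lift_definition uminus_locfun :: "locfun \<Rightarrow> locfun" is "\<lambda>f k D. Mul (Cst (-1)) (f k D)"
  by (auto simp: lf_fam_eq_def intro: mul_cong lf_eq.refl)
lift_definition minus_locfun :: "locfun \<Rightarrow> locfun \<Rightarrow> locfun" is
  "\<lambda>f g k D. Add (f k D) (Mul (Cst (-1)) (g k D))"
  by (auto simp: lf_fam_eq_def intro!: add_cong mul_cong lf_eq.refl)

instance
proof
  fix a b c :: locfun and r s :: real
  show "a + b + c = a + (b + c)"
    by transfer (auto simp: lf_fam_eq_def intro: add_assoc)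
  show "a + b = b + a"
    by transfer (auto simp: lf_fam_eq_def intro: add_comm)
  show "0 + a = a"
    by transfer (auto simp: lf_fam_eq_def intro: add_comm add_zero lf_eq.trans)
  show "- a + a = 0"
    by transfer (auto simp: lf_fam_eq_def intro: add_comm add_neg lf_eq.trans)
  show "a - b = a + - b"
    by transfer (auto simp: lf_fam_eq_def intro: lf_eq.refl)
  show "a * b * c = a * (b * c)"
    by transfer (auto simp: lf_fam_eq_def intro: mul_assoc)
  show "(a + b) * c = a * c + b * c"
    by transfer (auto simp: lf_fam_eq_def intro: distrib_r)
  show "a * (b + c) = a * b + a * c"
    by transfer (auto simp: lf_fam_eq_def intro: distrib_l)
  show "r *\<^sub>R (a + b) = r *\<^sub>R a + r *\<^sub>R b"
    by transfer (auto simp: lf_fam_eq_def intro: distrib_l)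
  show "(r + s) *\<^sub>R a = r *\<^sub>R a + s *\<^sub>R a"
    by transfer (auto simp: lf_fam_eq_def intro: lf_eq.trans[OF _ distrib_r] mul_cong lf_eq.refl lf_eq.sym[OF cst_add])
  show "r *\<^sub>R s *\<^sub>R a = (r * s) *\<^sub>R a"
    by transfer (auto simp: lf_fam_eq_def intro: lf_eq.trans[OF lf_eq.sym[OF mul_assoc]] mul_cong lf_eq.refl cst_mul)
  show "1 *\<^sub>R a = a"
    by transfer (auto simp: lf_fam_eq_def intro: mul_one_l)
  show "r *\<^sub>R a * b = r *\<^sub>R (a * b)"
    by transfer (auto simp: lf_fam_eq_def intro: mul_assoc)
  show "a * r *\<^sub>R b = r *\<^sub>R (a * b)"
    by transfer (auto simp: lf_fam_eq_def intro: lf_eq.trans[OF lf_eq.sym[OF mul_assoc]] lf_eq.trans[OF _ mul_assoc]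
        mul_cong lf_eq.refl lf_eq.sym[OF cst_central])
qed

end

text \<open>Extension by zero to all other parameters respects sums and products; the class of
  \<open>Cst 1\<close> is a unit only on the range of \<open>cls k D\<close>.\<close>

lift_definition cls :: "nat \<Rightarrow> nat \<Rightarrow> lf \<Rightarrow> locfun" is
  "\<lambda>k D a k' D'. if k' = k \<and> D' = D then a else Cst 0" .

lemma cls_eq_iff: "cls k D a = cls k D b \<longleftrightarrow> lf_eq k D a b"
  by transfer (auto simp: lf_fam_eq_def lf_eq.refl)

lemma cls_Cst0 [simp]: "cls k D (Cst 0) = 0"
  by transfer (auto simp: lf_fam_eq_def intro: lf_eq.refl)

lemma cls_eq_0_iff: "cls k D a = 0 \<longleftrightarrow> lf_eq k D a (Cst 0)"
  using cls_eq_iff[of k D a "Cst 0"] by simp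

lemma cls_Add [simp]: "cls k D (Add a b) = cls k D a + cls k D b"
  by transfer (auto simp: lf_fam_eq_def intro: lf_eq.refl lf_eq.sym[OF add_zero])

lemma cls_Cst_Mul [simp]: "cls k D (Mul (Cst c) a) = c *\<^sub>R cls k D a"
  by transfer (auto simp: lf_fam_eq_def intro: lf_eq.refl lf_eq.sym[OF lf_Cst_mul_zero])

lemma cls_Mul: "cls k D (Mul a b) = cls k D a * cls k D b"
  by transfer (auto simp: lf_fam_eq_def intro: lf_eq.refl lf_eq.sym[OF lf_zero_mul])

lemma cls_Mul_Cst [simp]: "cls k D (Mul a (Cst c)) = c *\<^sub>R cls k D a"
  unfolding cls_Cst_Mul[symmetric] cls_eq_iff by (rule lf_eq.sym) (rule cst_central)

lemma cls_Cst_times [simp]: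
  "cls k D (Cst c) * cls k D a = c *\<^sub>R cls k D a"
  "cls k D a * cls k D (Cst c) = c *\<^sub>R cls k D a"
  "cls k D (Cst c) * (cls k D a * x) = c *\<^sub>R (cls k D a * x)"
  by (simp_all flip: cls_Mul mult.assoc)

lemma cls_Cst_add [simp]: "cls k D (Cst x) + cls k D (Cst y) = cls k D (Cst (x + y))"
  unfolding cls_Add[symmetric] cls_eq_iff by (rule cst_add)

lemma scaleR_cls_Cst [simp]: "x *\<^sub>R cls k D (Cst y) = cls k D (Cst (x * y))"
  unfolding cls_Cst_Mul[symmetric] cls_eq_iff by (rule cst_mul)

lemma cls_smul [simp]: "cls k D (smul c a) = c *\<^sub>R cls k D a"
  by (simp add: smul_def)

lemma cls_lsum [simp]: "cls k D (lsum es) = sum_list (map (cls k D) es)"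
  by (induction es) (auto simp: lsum_def)

definition rep_at :: "nat \<Rightarrow> nat \<Rightarrow> locfun \<Rightarrow> lf" where
  "rep_at k D x = rep_locfun x k D"

lemma lf_eq_rep_locfun_abs: "lf_eq k D (rep_locfun (abs_locfun f) k D) (f k D)"
  using rep_abs_rsp_left[OF Quotient3_locfun, of f f] equivp_reflp[OF equivp_lf_fam_eq]
  by (auto simp: lf_fam_eq_def)

lemma lf_eq_rep_at_cls: "lf_eq k D (rep_at k D (cls k D a)) a"
  using lf_eq_rep_locfun_abs[of k D "\<lambda>k' D'. if k' = k \<and> D' = D then a else Cst 0"]
  by (simp add: rep_at_def cls.abs_eq)

lemma rep_at_add: "lf_eq k D (rep_at k D (x + y)) (Add (rep_at k D x) (rep_at k D y))"
proof -
  have "x + y = abs_locfun (\<lambda>k D. Add (rep_locfun x k D) (rep_locfun y k D))"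
    by (metis Quotient3_abs_rep Quotient3_locfun plus_locfun.abs_eq)
  then show ?thesis
    unfolding rep_at_def
    using lf_eq_rep_locfun_abs[of k D "\<lambda>k D. Add (rep_locfun x k D) (rep_locfun y k D)"] by simp
qed

lemma rep_at_scale: "lf_eq k D (rep_at k D (c *\<^sub>R x)) (Mul (Cst c) (rep_at k D x))"
proof -
  have "c *\<^sub>R x = abs_locfun (\<lambda>k D. Mul (Cst c) (rep_locfun x k D))"
    by (metis Quotient3_abs_rep Quotient3_locfun scaleR_locfun.abs_eq)
  then show ?thesis
    unfolding rep_at_def
    using lf_eq_rep_locfun_abs[of k D "\<lambda>k D. Mul (Cst c) (rep_locfun x k D)"] by simp
qed

section \<open>Grassmann parity and graded commutativity\<close>

definition sgn_of :: "bool \<Rightarrow> real" where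
  "sgn_of b = (if b then -1 else 1)"

fun parity_hom :: "bool \<Rightarrow> lf \<Rightarrow> bool" where
  "parity_hom b (Gen K xs ys d) = (odd_kind K = b)"
| "parity_hom b (Cst c) = (\<not> b \<or> c = 0)"
| "parity_hom b (Add x y) = (parity_hom b x \<and> parity_hom b y)"
| "parity_hom b (Mul x y) = (\<exists>b1 b2. b = (b1 \<noteq> b2) \<and> parity_hom b1 x \<and> parity_hom b2 y)"

lemma parity_hom_smul [simp]: "parity_hom b e \<Longrightarrow> parity_hom b (smul c e)"
  by (auto simp: smul_def)

lemma parity_hom_lsum [simp]: "(\<And>e. e \<in> set es \<Longrightarrow> parity_hom b e) \<Longrightarrow> parity_hom b (lsum es)"
  by (induction es) (auto simp: lsum_def)

lemma parity_hom_dlf: "parity_hom b e \<Longrightarrow> parity_hom b (dlf \<mu> e)"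
  by (induction e arbitrary: b) auto

lemma parity_hom_derivs: "parity_hom b e \<Longrightarrow> parity_hom b (derivs d e)"
proof -
  have "parity_hom b e \<Longrightarrow> parity_hom b (fold dlf ds e)" for ds
    by (induction ds arbitrary: e) (auto simp: parity_hom_dlf)
  then show "parity_hom b e \<Longrightarrow> parity_hom b (derivs d e)"
    by (simp add: derivs_def)
qed

text \<open>Homogeneity makes \<open>par\<close> act on each relation by a scalar, so that
  \<open>par\<close> descends to the quotient.\<close>

lemma rels_parity_hom: "r \<in> rels k D \<Longrightarrow> \<exists>b. parity_hom b r"
proof (induction rule: rels.induct)
  case (young j ys K xs d)
  show ?case by (rule exI[of _ "odd_kind K"]) (auto intro!: parity_hom_smul parity_hom_lsum)
qed (auto intro!: exI parity_hom_smul)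

locale local_functions =
  fixes k D :: nat
begin

abbreviation J :: "lf \<Rightarrow> locfun" where "J \<equiv> cls k D"

lemma J_par: "parity_hom b a \<Longrightarrow> J (par a) = sgn_of b *\<^sub>R J a"
proof (induction a arbitrary: b)
  case (Mul x y)
  then obtain b1 b2 where "b = (b1 \<noteq> b2)" "parity_hom b1 x" "parity_hom b2 y" by auto
  then show ?case using Mul.IH by (auto simp: cls_Mul sgn_of_def)
qed (auto simp: sgn_of_def scaleR_add_right)

lemma J_rel: "r \<in> rels k D \<Longrightarrow> J r = 0"
  by (simp add: cls_eq_0_iff rel)

lemma J_par_cong: "lf_eq k D a b \<Longrightarrow> J (par a) = J (par b)"
proof (induction rule: lf_eq.induct)
  case (rel r)
  then obtain b where "parity_hom b r" using rels_parity_hom by blast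
  then show ?case using J_par J_rel[OF rel] by simp
next
  case (supercomm K xs ys d K' xs' ys' d')
  have "J (Mul (Gen K xs ys d) (Gen K' xs' ys' d')) = J (Mul (Cst (if odd_kind K \<and> odd_kind K' then -1 else 1))
      (Mul (Gen K' xs' ys' d') (Gen K xs ys d)))"
    unfolding cls_eq_iff by (rule lf_eq.supercomm)
  then show ?case
    by (simp add: cls_Mul split: if_splits)
qed (simp_all add: cls_Mul algebra_simps)

lemma J_par_par: "J (par (par a)) = J a"
  by (induction a) (auto simp: cls_Mul smul_def)

text \<open>The sign is multiplicative in each parity, so a nested induction extends the rule from
  pairs of generators to homogeneous expressions.\<close>

lemma supercommute:
  "parity_hom b1 x \<Longrightarrow> parity_hom b2 y \<Longrightarrow> J x * J y = koszul b1 b2 *\<^sub>R (J y * J x)"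
proof (induction x arbitrary: b1)
  case (Gen K xs ys d)
  from Gen(2) show ?case
  proof (induction y arbitrary: b2)
    case (Gen K' xs' ys' d')
    have "J (Mul (lf.Gen K xs ys d) (lf.Gen K' xs' ys' d')) = J (Mul (Cst (if odd_kind K \<and> odd_kind K' then -1 else 1))
      (Mul (lf.Gen K' xs' ys' d') (lf.Gen K xs ys d)))"
      unfolding cls_eq_iff by (rule lf_eq.supercomm)
    then show ?case
      using Gen \<open>parity_hom b1 (lf.Gen K xs ys d)\<close> by (auto simp: cls_Mul koszul_def split: if_splits)
  next
    case (Cst c)
    then show ?case
      by (auto simp flip: cls_Mul)
  next
    case (Add y1 y2)
    then show ?case by (auto simp: distrib_left distrib_right scaleR_add_right)
  next
    case (Mul y1 y2)
    then obtain c1 c2 where c: "b2 = (c1 \<noteq> c2)" "parity_hom c1 y1" "parity_hom c2 y2" by auto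
    let ?g = "J (lf.Gen K xs ys d)"
    have "?g * J (Mul y1 y2) = (?g * J y1) * J y2" by (simp add: cls_Mul mult.assoc)
    also have "\<dots> = koszul b1 c1 *\<^sub>R (J y1 * (?g * J y2))"
      using Mul.IH(1)[OF c(2)] by (simp add: mult.assoc)
    also have "\<dots> = (koszul b1 c1 * koszul b1 c2) *\<^sub>R (J y1 * J y2 * ?g)"
      using Mul.IH(2)[OF c(3)] by (simp add: mult.assoc)
    also have "koszul b1 c1 * koszul b1 c2 = koszul b1 b2"
      by (auto simp: c koszul_def)
    finally show ?case by (simp add: cls_Mul mult.assoc)
  qed
next
  case (Cst c)
  then show ?case
    by (auto simp flip: cls_Mul)
next
  case (Add x1 x2)
  then show ?case by (auto simp: distrib_left distrib_right scaleR_add_right)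
next
  case (Mul x1 x2)
  then obtain c1 c2 where c: "b1 = (c1 \<noteq> c2)" "parity_hom c1 x1" "parity_hom c2 x2" by auto
  have "J (Mul x1 x2) * J y = J x1 * (J x2 * J y)" by (simp add: cls_Mul mult.assoc)
  also have "\<dots> = koszul c2 b2 *\<^sub>R ((J x1 * J y) * J x2)"
    using Mul.IH(2)[OF c(3) Mul.prems(2)] by (simp add: mult.assoc)
  also have "\<dots> = (koszul c2 b2 * koszul c1 b2) *\<^sub>R (J y * (J x1 * J x2))"
    using Mul.IH(1)[OF c(2) Mul.prems(2)] by (simp add: mult.assoc)
  also have "koszul c2 b2 * koszul c1 b2 = koszul b1 b2"
    by (auto simp: c koszul_def)
  finally show ?case by (simp add: cls_Mul)
qed

end

section \<open>Odd derivations of the quotient and their anticommutator\<close>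

locale odd_derivation = local_functions +
  fixes \<delta> :: "lf \<Rightarrow> lf"
  assumes Cst_eq: "\<delta> (Cst c) = Cst 0"
    and Add_eq: "\<delta> (Add a b) = Add (\<delta> a) (\<delta> b)"
    and Mul_eq: "\<delta> (Mul a b) = Add (Mul a (\<delta> b)) (Mul (\<delta> a) (par b))"
    and parity: "parity_hom (\<not> odd_kind K) (\<delta> (Gen K xs ys d))"
    and rels: "r \<in> rels k D \<Longrightarrow> J (\<delta> r) = 0"
begin

lemma J_Mul: "J (\<delta> (Mul a b)) = J a * J (\<delta> b) + J (\<delta> a) * J (par b)"
  by (simp add: Mul_eq cls_Mul)

lemma J_Cst_Mul: "J (\<delta> (Mul (Cst c) a)) = c *\<^sub>R J (\<delta> a)"
  by (simp add: Mul_eq Cst_eq)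

text \<open>Well-definedness on the quotient. Besides the relations, the case with content is the
  exchange of two generators, where each is supercommuted past the image of the other.\<close>

lemma cong: "lf_eq k D a b \<Longrightarrow> J (\<delta> a) = J (\<delta> b)"
proof (induction rule: lf_eq.induct)
  case (mul_cong a a' b b')
  then have "J a = J a'" "J b = J b'" by (simp_all add: cls_eq_iff)
  with mul_cong.IH J_par_cong[OF mul_cong.hyps(2)] show ?case
    by (simp only: J_Mul)
next
  case (rel r)
  then show ?case using rels Cst_eq by simp
next
  case (supercomm K xs ys d K' xs' ys' d')
  define g g' where "g = Gen K xs ys d" and "g' = Gen K' xs' ys' d'"
  define s where "s = koszul (odd_kind K) (odd_kind K')"
  have p: "parity_hom (odd_kind K) g" "parity_hom (odd_kind K') g'"
    "parity_hom (\<not> odd_kind K) (\<delta> g)" "parity_hom (\<not> odd_kind K') (\<delta> g')"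
    by (simp_all add: g_def g'_def parity)
  have "J (\<delta> (Mul g g')) = s *\<^sub>R J (\<delta> (Mul g' g))"
    unfolding J_Mul J_par[OF p(1)] J_par[OF p(2)]
    using supercommute[OF p(1) p(4)] supercommute[OF p(3) p(2)]
    by (auto simp: s_def koszul_def sgn_of_def algebra_simps)
  then show ?case
    by (simp add: g_def g'_def s_def koszul_def J_Cst_Mul)
qed (simp_all add: Cst_eq Add_eq J_Mul J_Cst_Mul cls_Mul algebra_simps)

lemma par: "J (par (\<delta> a)) = - J (\<delta> (par a))"
proof (induction a)
  case (Gen K xs ys d)
  show ?case
    by (simp add: J_par[OF parity] sgn_of_def smul_def J_Cst_Mul)
next
  case (Cst c)
  show ?case by (simp add: Cst_eq)
next
  case (Add a b)
  then show ?case by (simp add: Add_eq)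
next
  case (Mul a b)
  then show ?case by (simp add: Mul_eq cls_Mul algebra_simps)
qed

text \<open>Total on \<open>locfun\<close>, through the representative at \<open>k\<close> and
  \<open>D\<close>, so that linear algebra on a whole type applies.\<close>

definition lift :: "locfun \<Rightarrow> locfun" where
  "lift x = J (\<delta> (rep_at k D x))"

lemma lift_J [simp]: "lift (J a) = J (\<delta> a)"
  unfolding lift_def by (rule cong) (rule lf_eq_rep_at_cls)

lemma linear_lift: "linear lift"
proof (rule linearI)
  show "lift (x + y) = lift x + lift y" for x y
    using cong[OF rep_at_add[of k D x y]] by (simp add: lift_def Add_eq)
  show "lift (c *\<^sub>R x) = c *\<^sub>R lift x" for c x
    using cong[OF rep_at_scale[of k D c x]] by (simp add: lift_def J_Cst_Mul)
qed

text \<open>The square of an odd derivation is an even derivation, since the mixed terms cancel by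
  the anticommutation of \<open>\<delta>\<close> with \<open>par\<close>; hence generators
  decide.\<close>

lemma square_zero:
  assumes "\<And>K xs ys d. J (\<delta> (\<delta> (Gen K xs ys d))) = 0"
  shows "J (\<delta> (\<delta> a)) = 0"
proof (induction a)
  case (Mul a b)
  then show ?case
    by (simp add: Mul_eq Add_eq cls_Mul par J_par_par)
qed (simp_all add: assms Cst_eq Add_eq)

end

locale two_odd_derivations = g: odd_derivation k D \<gamma> + h: odd_derivation k D \<eta>
  for k D \<gamma> \<eta>
begin

definition laplace :: "locfun \<Rightarrow> locfun" where
  "laplace x = g.lift (h.lift x) + h.lift (g.lift x)"

lemma linear_laplace: "linear laplace"
  unfolding laplace_def
  by (intro linear_compose_add linear_compose[of h.lift g.lift, unfolded o_def]
      linear_compose[of g.lift h.lift, unfolded o_def] g.linear_lift h.linear_lift)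

text \<open>The mixed terms cancel in pairs because both derivations anticommute with
  \<open>par\<close>.\<close>

lemma laplace_mult: "laplace (g.J a * g.J b) = laplace (g.J a) * g.J b + g.J a * laplace (g.J b)"
  unfolding laplace_def cls_Mul[symmetric] g.lift_J h.lift_J
  by (simp add: g.Mul_eq h.Mul_eq g.Add_eq h.Add_eq cls_Mul g.par h.par g.J_par_par algebra_simps)

end

section \<open>Homotopies with diagonalizable Laplacian\<close>

text \<open>By induction \<open>(L - c) v\<close> is a sum of eigenvectors with eigenvalues other
  than \<open>c\<close>. On those \<open>L - c\<close> is invertible, which gives some
  \<open>w\<close> with the same image, and \<open>v - w\<close> is an eigenvector for
  \<open>c\<close>.\<close>

lemma eigenvector_decomposition:
  fixes L :: "'a::real_vector \<Rightarrow> 'a"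
  assumes L: "linear L" and V: "subspace V" "\<And>x. x \<in> V \<Longrightarrow> L x \<in> V"
  shows "distinct cs \<Longrightarrow> v \<in> V \<Longrightarrow> fold (\<lambda>c x. L x - c *\<^sub>R x) cs v = 0 \<Longrightarrow>
    v \<in> span {x \<in> V. \<exists>c\<in>set cs. L x = c *\<^sub>R x}"
proof (induction cs arbitrary: v)
  case Nil
  then show ?case by (simp add: span_zero)
next
  case (Cons c cs)
  let ?E = "\<lambda>cs. {x \<in> V. \<exists>c\<in>set cs. L x = c *\<^sub>R x}"
  define u where "u = L v - c *\<^sub>R v"
  have "u \<in> V"
    unfolding u_def using Cons.prems V by (intro subspace_diff subspace_scale) auto
  then have "u \<in> span (?E cs)"
    using Cons by (simp add: u_def)
  then have "\<exists>w\<in>span (?E cs). L w - c *\<^sub>R w = u"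
  proof (induction rule: span_induct_alt)
    case base
    show ?case by (rule bexI[of _ 0]) (simp_all add: linear_0[OF L] span_zero)
  next
    case (step a x y)
    then obtain w where w: "w \<in> span (?E cs)" "L w - c *\<^sub>R w = y" by blast
    from step obtain e where e: "x \<in> V" "e \<in> set cs" "L x = e *\<^sub>R x" by blast
    with Cons.prems have ne: "e \<noteq> c" by auto
    have "x \<in> span (?E cs)" using e by (intro span_base) auto
    \<comment> \<open>Solves (L - c) (b x) = a x for the eigenvector \<open>x\<close> with
      eigenvalue \<open>e\<close>.\<close>
    define b where "b = a / (e - c)"
    have "b * (e - c) = a"
      using ne by (simp add: b_def)
    then have b: "b * e - b * c = a"
      by (simp add: right_diff_distrib)
    have "b *\<^sub>R x + w \<in> span (?E cs)"
      using \<open>x \<in> span (?E cs)\<close> w by (intro span_add span_scale)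
    moreover have "L (b *\<^sub>R x + w) - c *\<^sub>R (b *\<^sub>R x + w) = (b * e - b * c) *\<^sub>R x + (L w - c *\<^sub>R w)"
      by (simp add: linear_add[OF L] linear_scale[OF L] e algebra_simps)
    ultimately show ?case
      unfolding b w by blast
  qed
  then obtain w where w: "w \<in> span (?E cs)" "L w - c *\<^sub>R w = u" by blast
  have "w \<in> V"
    using w(1) span_minimal[OF _ V(1), of "?E cs"] by auto
  then have "v - w \<in> ?E (c # cs)"
    using Cons.prems w(2) subspace_diff[OF V(1)] by (auto simp: u_def linear_diff[OF L] algebra_simps)
  then have "v - w \<in> span (?E (c # cs))" by (rule span_base)
  moreover have "w \<in> span (?E (c # cs))"
    using w(1) span_mono[of "?E cs" "?E (c # cs)"] by auto
  ultimately show ?case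
    using span_add[of "v - w" "?E (c # cs)" w] by simp
qed

text \<open>Lying in the bicommutant of \<open>L\<close>, the inverses belonging to different eigenvectors can be combined, and
  they commute with every differential that commutes with \<open>L\<close>.\<close>

lemma bicommutant_inverse:
  fixes L :: "'a::real_vector \<Rightarrow> 'a"
  assumes L: "linear L" and v: "v \<in> span {x. \<exists>c. c \<noteq> 0 \<and> L x = c *\<^sub>R x}"
  shows "\<exists>T. linear T \<and> (\<forall>U. linear U \<longrightarrow> (\<forall>x. U (L x) = L (U x)) \<longrightarrow> (\<forall>x. U (T x) = T (U x))) \<and> T (L v) = v"
  using v
proof (induction rule: span_induct_alt)
  case base
  show ?case by (rule exI[of _ "\<lambda>x. 0"]) (simp add: linear_0 module_hom_zero)
next
  case (step a x y)
  then obtain T c where T: "linear T" "T (L y) = y" and c: "c \<noteq> 0" "L x = c *\<^sub>R x"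
    and comm: "\<And>U x. linear U \<Longrightarrow> (\<And>x. U (L x) = L (U x)) \<Longrightarrow> U (T x) = T (U x)"
    by blast
  \<comment> \<open>Chosen so that 1 - T' L = (1 - T L) (1 - L / c): the second factor kills
    \<open>x\<close> and the first kills \<open>y\<close>.\<close>
  define T' where "T' z = (1 / c) *\<^sub>R z + T z - (1 / c) *\<^sub>R T (L z)" for z
  have lin: "linear T'"
    unfolding T'_def
    by (rule linearI) (simp_all add: linear_add[OF T(1)] linear_scale[OF T(1)] linear_add[OF L] linear_scale[OF L] algebra_simps)
  have "U (T' z) = T' (U z)" if U: "linear U" "\<And>x. U (L x) = L (U x)" for U z
    by (simp add: T'_def linear_add[OF U(1)] linear_diff[OF U(1)] linear_scale[OF U(1)] comm[OF U] U(2))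
  moreover have "T' (L (a *\<^sub>R x + y)) = a *\<^sub>R x + y"
    using comm[OF L, of "L y"] c
    by (simp add: T'_def linear_add[OF T(1)] linear_scale[OF T(1)] linear_add[OF L] linear_scale[OF L] T(2) algebra_simps)
  ultimately show ?case using lin by blast
qed

text \<open>An inverse \<open>T\<close> of the Laplacian at \<open>v\<close> that commutes with
  \<open>\<Gamma>\<close> gives v = T (\<Gamma> (H v)) = \<Gamma> (T (H v)) for closed
  \<open>v\<close>.\<close>

lemma homotopy_exact:
  fixes \<Gamma> H :: "'a::real_vector \<Rightarrow> 'a"
  assumes G: "linear \<Gamma>" "\<And>x. \<Gamma> (\<Gamma> x) = 0" and H: "linear H"
    and v: "v \<in> span {x. \<exists>c. c \<noteq> 0 \<and> \<Gamma> (H x) + H (\<Gamma> x) = c *\<^sub>R x}" and closed: "\<Gamma> v = 0"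
  shows "\<exists>w. v = \<Gamma> w"
proof -
  let ?L = "\<lambda>x. \<Gamma> (H x) + H (\<Gamma> x)"
  have L: "linear ?L"
    by (rule linearI) (simp_all add: linear_add[OF G(1)] linear_add[OF H] linear_scale[OF G(1)] linear_scale[OF H] scaleR_add_right)
  have comm: "\<Gamma> (?L x) = ?L (\<Gamma> x)" for x
    by (simp add: linear_add[OF G(1)] G(2) linear_0[OF G(1)] linear_0[OF H])
  obtain T where T: "linear T" "\<And>x. \<Gamma> (T x) = T (\<Gamma> x)" "T (?L v) = v"
    using bicommutant_inverse[OF L v] G(1) comm by blast
  have "v = \<Gamma> (T (H v))"
    using T(3) by (simp add: closed linear_0[OF H] T(2))
  then show ?thesis by blast
qed

lemma span_mult_closed:
  fixes x y :: "'a::real_algebra"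
  assumes x: "x \<in> span A" and y: "y \<in> span B" and AB: "\<And>a b. a \<in> A \<Longrightarrow> b \<in> B \<Longrightarrow> a * b \<in> C"
  shows "x * y \<in> span C"
  using x
proof (induction rule: span_induct_alt)
  case (step c a x)
  have "a * y \<in> span C"
    using y
  proof (induction rule: span_induct_alt)
    case (step d b y)
    have "a * b \<in> span C"
      using AB \<open>a \<in> A\<close> step by (intro span_base)
    then have "d *\<^sub>R (a * b) + a * y \<in> span C"
      using step by (intro span_add span_scale)
    then show ?case by (simp add: distrib_left)
  qed (simp add: span_zero)
  then have "c *\<^sub>R (a * y) + x * y \<in> span C"
    using step by (intro span_add span_scale)
  then show ?case by (simp add: distrib_right)
qed (simp add: span_zero)

section \<open>The ghost tower\<close>

lemma derivs_Gen: "derivs d (Gen K xs ys e) = Gen K xs ys (e + d)"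
proof -
  have "fold dlf ds (Gen K xs ys e) = Gen K xs ys (e + mset ds)" for ds
    by (induction ds arbitrary: e) auto
  then show ?thesis by (simp add: derivs_def)
qed

lemma derivs_Add: "derivs d (Add a b) = Add (derivs d a) (derivs d b)"
proof -
  have "fold dlf ds (Add a b) = Add (fold dlf ds a) (fold dlf ds b)" for ds
    by (induction ds arbitrary: a b) auto
  then show ?thesis by (simp add: derivs_def)
qed

lemma derivs_Cst: "cls k D (derivs d (Cst c)) = (if d = {#} then cls k D (Cst c) else 0)"
proof -
  have 0: "fold dlf ds (Cst 0) = Cst 0" for ds
    by (induction ds) auto
  have "cls k D (fold dlf ds (Cst c)) = (if ds = [] then cls k D (Cst c) else 0)" for ds
    by (cases ds) (auto simp: 0)
  then show ?thesis
    by (auto simp: derivs_def) (metis mset.simps(1) mset_sorted_list_of_multiset)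
qed

text \<open>An identity of classes only: on expressions the product rule adds terms with the factor
  \<open>Cst 0\<close>.\<close>

lemma cls_derivs_smul: "cls k D (derivs d (smul c e)) = c *\<^sub>R cls k D (derivs d e)"
proof -
  have 0: "cls k D (fold dlf ds (Mul (Cst 0) e)) = 0" for ds e
  proof (induction ds arbitrary: e)
    case (Cons \<mu> ds)
    have "fold dlf ds (Add a b) = Add (fold dlf ds a) (fold dlf ds b)" for a b
      by (induction ds arbitrary: a b) auto
    then show ?case using Cons by simp
  qed simp
  have "cls k D (fold dlf ds (Mul (Cst c) e)) = c *\<^sub>R cls k D (fold dlf ds e)" for ds
  proof (induction ds arbitrary: e)
    case (Cons \<mu> ds)
    have "fold dlf ds (Add a b) = Add (fold dlf ds a) (fold dlf ds b)" for a b
      by (induction ds arbitrary: a b) auto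
    then show ?case using Cons by (simp add: 0)
  qed simp
  then show ?thesis by (simp add: derivs_def smul_def)
qed

lemma cls_derivs_lsum: "cls k D (derivs d (lsum es)) = sum_list (map (\<lambda>e. cls k D (derivs d e)) es)"
proof (induction es)
  case Nil
  show ?case by (simp add: lsum_def derivs_Cst)
next
  case (Cons e es)
  then show ?case by (simp add: lsum_def derivs_Add)
qed

lemma cls_derivs_curl2:
  "cls k D (derivs d (curl2 m xs ys)) =
    (\<Sum>j<length ys. (-1) ^ j *\<^sub>R cls k D (Gen (Gh m) xs (delete_at j ys) (add_mset (ys ! j) d)))"
  by (simp add: curl2_def cls_derivs_lsum cls_derivs_smul derivs_Gen o_def interv_sum_list_conv_sum_set_nat
      atLeast0LessThan)

lemma sum_list_concat: "sum_list (concat xss) = sum_list (map sum_list xss)"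
  for xss :: "'a::monoid_add list list"
  by (induction xss) auto

lemma cls_derivs_curl12:
  "cls k D (derivs d (curl12 m xs ys)) =
    (\<Sum>i<length xs. \<Sum>j<length ys. (-1) ^ (i + j) *\<^sub>R
      cls k D (Gen (Gh m) (delete_at i xs @ [ys ! j]) (delete_at j ys) (add_mset (xs ! i) d)))"
  by (simp add: curl12_def cls_derivs_lsum cls_derivs_smul derivs_Gen o_def map_concat sum_list_concat
      interv_sum_list_conv_sum_set_nat atLeast0LessThan)

section \<open>Generators as a graded-symmetric function of words\<close>

context local_functions
begin

text \<open>A word that is not in normal order is read as its reordering, with the sign of the reordering.\<close>

definition gen :: "kind \<Rightarrow> nat word \<Rightarrow> locfun" where
  "gen K w = inv_sign w *\<^sub>R J (Gen K (proj First w) (proj Second w) (mset (proj Deriv w)))"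

lemma gen_normal_word: "gen K (normal_word xs ys ds) = J (Gen K xs ys (mset ds))"
  by (simp add: gen_def)

lemma J_invalid: "\<not> valid_gen k D K xs ys d \<Longrightarrow> J (Gen K xs ys d) = 0"
  by (intro J_rel rels.invalid)

lemma J_antisym1:
  assumes "\<sigma> permutes {..<length xs}"
  shows "J (Gen K (permute_list \<sigma> xs) ys d) = of_int (sign \<sigma>) *\<^sub>R J (Gen K xs ys d)"
  using J_rel[OF rels.antisym1[OF assms]] by simp

lemma J_antisym2:
  assumes "\<sigma> permutes {..<length ys}"
  shows "J (Gen K xs (permute_list \<sigma> ys) d) = of_int (sign \<sigma>) *\<^sub>R J (Gen K xs ys d)"
  using J_rel[OF rels.antisym2[OF assms]] by simp

lemma J_young:
  assumes "j < length ys"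
  shows "J (Gen K xs ys d) = (\<Sum>i<length xs. J (Gen K (xs[i := ys ! j]) (ys[j := xs ! i]) d))"
  using J_rel[OF rels.young[OF assms]]
  by (simp add: o_def interv_sum_list_conv_sum_set_nat atLeast0LessThan)

lemma permute_adjacent:
  "permute_list (transpose (length A) (Suc (length A))) (A @ x # y # B) = A @ y # x # B"
  using permute_list_transpose(1)[of "length A" "Suc (length A)" "A @ x # y # B"]
  by (simp add: nth_append)

text \<open>Letters of one column are exchanged by its antisymmetry, derivatives commute in the
  multiset, and between the two columns the sign comes from \<open>inv_sign\<close>.\<close>

lemma supersym_gen: "supersym (gen K)"
proof (rule supersymI)
  fix u v :: "nat word" and a b :: "slot \<times> nat"
  let ?A = "\<lambda>c. proj c u" and ?B = "\<lambda>c. proj c v"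
  obtain c x d y where ab: "a = (c, x)" "b = (d, y)" by (cases a; cases b)
  have 1: "J (Gen K (?A First @ x # y # ?B First) Y Z) = - J (Gen K (?A First @ y # x # ?B First) Y Z)" for Y Z
    using J_antisym1[of "transpose (length (?A First)) (Suc (length (?A First)))" "?A First @ y # x # ?B First" K Y Z]
    by (simp add: permute_adjacent sign_swap_id permutes_swap_id)
  have 2: "J (Gen K X (?A Second @ x # y # ?B Second) Z) = - J (Gen K X (?A Second @ y # x # ?B Second) Z)" for X Z
    using J_antisym2[of "transpose (length (?A Second)) (Suc (length (?A Second)))" "?A Second @ y # x # ?B Second" K X Z]
    by (simp add: permute_adjacent sign_swap_id permutes_swap_id)
  show "gen K (u @ a # b # v) = koszul (odd_slot (fst a)) (odd_slot (fst b)) *\<^sub>R gen K (u @ b # a # v)"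
    by (cases c; cases d)
       (simp_all add: gen_def ab inv_sign_append odd_slot_def 1 2 add_mset_commute)
qed

lemma young_gen: "polar Second First (gen K) = 0"
proof (rule supersym_young_vanishes[OF supersym_gen])
  show "gen K (normal_word xs (y # ys) ds) = (\<Sum>i<length xs. gen K (normal_word (xs[i := y]) (xs ! i # ys) ds))"
    for xs y ys ds
    using J_young[of 0 "y # ys" K xs "mset ds"] unfolding gen_normal_word by simp
qed

fun col2 :: "kind \<Rightarrow> nat" where
  "col2 Fld = k"
| "col2 FldS = k"
| "col2 (Gh m) = k - m - 1"
| "col2 (GhS m) = k - m - 1"

lemma gen_support:
  assumes "gen K w \<noteq> 0"
  shows "length (proj First w) = k" "length (proj Second w) = col2 K" "\<forall>l\<in>set w. snd l < D"
proof -
  have valid: "valid_gen k D K (proj First w) (proj Second w) (mset (proj Deriv w))"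
    using assms J_invalid by (fastforce simp: gen_def)
  then show "length (proj First w) = k" "length (proj Second w) = col2 K"
    by (auto simp: valid_gen_def split: kind.splits)
  show "\<forall>l\<in>set w. snd l < D"
  proof
    fix l assume l: "l \<in> set w"
    obtain c x where cx: "l = (c, x)" by (cases l)
    have "x \<in> set (proj c w)"
      using l by (force simp: proj_def cx)
    then show "snd l < D"
      using valid by (cases c) (auto simp: valid_gen_def cx)
  qed
qed

lemma weight_gen:
  "polar First First (gen K) = real k *\<^sub>R gen K"
  "polar Second Second (gen K) = real (col2 K) *\<^sub>R gen K"
proof -
  show "polar First First (gen K) = real k *\<^sub>R gen K"
    using gen_support(1)[of K] by (fastforce simp: fun_eq_iff polar_diagonal)
  show "polar Second Second (gen K) = real (col2 K) *\<^sub>R gen K"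
    using gen_support(2)[of K] by (fastforce simp: fun_eq_iff polar_diagonal)
qed

lemma gen_ghost_beyond: "k \<le> m \<Longrightarrow> gen (Gh m) = 0"
  by (auto simp: gen_def fun_eq_iff valid_gen_def intro!: J_invalid)

lemma young_symmetric_gen: "young_symmetric (gen K) k (col2 K)"
  by unfold_locales (simp_all add: supersym_gen weight_gen young_gen, cases K, auto)

section \<open>The action of \<gamma> on generators in terms of polarizations\<close>

lemma polar_Deriv_Second_gen:
  "polar Deriv Second (gen (Gh m)) (normal_word xs ys ds) =
    (-1) ^ length xs *\<^sub>R cls k D (derivs (mset ds) (curl2 m xs ys))"
  unfolding normal_word_def
  by (simp add: polar_block_other polar_block_same polar_absent odd_slot_def cls_derivs_curl2
      gen_def inv_sign_append delete_at_def)

text \<open>Inner part of \<open>curl12\<close>: \<open>(Deriv, z)\<close> marks the first-column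
  index that became a derivative. The letter \<open>ys ! j\<close>, now of kind
  \<open>First\<close>, crosses \<open>j\<close> letters of the second column, whence the
  sign.\<close>

lemma polar_First_Second_gen_hole:
  "polar First Second (gen (Gh m)) (map (Pair First) X @ (Deriv, z) # map (Pair First) Y @ map (Pair Second) ys @ map (Pair Deriv) ds)
    = (\<Sum>j<length ys. (-1) ^ j *\<^sub>R
        J (Gen (Gh m) (X @ Y @ [ys ! j]) (delete_at j ys) (add_mset z (mset ds))))"
  by (simp add: polar_block_other polar_block_same polar_absent odd_slot_def
      gen_def inv_sign_append delete_at_def)

lemma polar_curl12_gen:
  "polar Deriv First (polar First Second (gen (Gh m))) (normal_word xs ys ds) =
    cls k D (derivs (mset ds) (curl12 m xs ys))"
  unfolding normal_word_def
  by (simp add: polar_block_same polar_block_other polar_absent odd_slot_def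
      polar_First_Second_gen_hole cls_derivs_curl12 delete_at_def scaleR_sum_right power_add)

text \<open>The factor (-1)^k between \<open>curl2\<close> and \<open>polar Deriv Second\<close>
  turns the coefficient (-1)^(k+1) (m + 2) of \<open>gamma_gen\<close> into -(m + 2).\<close>

definition grad_gen :: "kind \<Rightarrow> nat word \<Rightarrow> locfun" where
  "grad_gen K = (case K of
      Fld \<Rightarrow> (-1) ^ (k + 1) *\<^sub>R grad 1 (gen (Gh 0))
    | Gh m \<Rightarrow> grad (real m + 2) (gen (Gh (m + 1)))
    | _ \<Rightarrow> 0)"

lemma supersym_zero: "supersym 0"
  by (rule supersymI) simp

lemma grad_zero: "grad r 0 = 0"
  by (simp add: grad_def polar_zero)

lemma supersym_grad_gen: "supersym (grad_gen K)"
  unfolding grad_gen_def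
  by (cases K) (simp_all only: kind.case supersym_zero supersym_scale supersym_grad supersym_gen)

lemma grad_gen_weight:
  assumes "k \<noteq> 0"
  shows "polar First First (grad r (gen K)) = real k *\<^sub>R grad r (gen K)"
    and "polar Second Second (grad r (gen K)) = real (Suc (col2 K)) *\<^sub>R grad r (gen K)"
  by (simp_all add: grad_def polar_weight polar_linear polar_normal_order weight_gen algebra_simps scaleR_add_left)

lemma polar_indices:
  assumes "\<And>w. F w \<noteq> 0 \<Longrightarrow> \<forall>l\<in>set w. snd l < D" "polar i j F w \<noteq> 0"
  shows "\<forall>l\<in>set w. snd l < D"
proof (rule ccontr)
  assume *: "\<not> ?thesis"
  have "polar i j F w = 0"
  proof (rule polar_eq_0)
    fix u x v assume "w = u @ (j, x) # v"
    with * show "F (u @ (i, x) # v) = 0"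
      using assms(1)[of "u @ (i, x) # v"] by auto
  qed
  with assms(2) show False by simp
qed

lemma grad_gen_indices:
  assumes "grad r (gen K) w \<noteq> 0"
  shows "\<forall>l\<in>set w. snd l < D"
proof -
  have "polar Deriv First (polar First Second (gen K)) w \<noteq> 0 \<or> polar Deriv Second (gen K) w \<noteq> 0"
    using assms by (auto simp: grad_def)
  moreover have 1: "\<forall>l\<in>set w. snd l < D" if "polar i j (gen K) w \<noteq> 0" for i j w
    by (rule polar_indices[OF gen_support(3) that])
  moreover have "\<forall>l\<in>set w. snd l < D" if "polar Deriv First (polar First Second (gen K)) w \<noteq> 0"
    by (rule polar_indices[OF 1 that])
  ultimately show ?thesis by blast
qed

text \<open>As \<open>gamma\<close> sends invalid generators to zero, the polarization formula has
  to vanish on them as well.\<close>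

lemma grad_gen_support:
  assumes "0 < k" "grad_gen K w \<noteq> 0"
  shows "valid_gen k D K (proj First w) (proj Second w) (mset (proj Deriv w))"
proof -
  have supp: "length (proj First w) = k" "length (proj Second w) = Suc (col2 K')"
    "\<forall>x\<in>set (proj c w). x < D"
    if "grad r (gen K') w \<noteq> 0" for r K' c
  proof -
    show "length (proj First w) = k" "length (proj Second w) = Suc (col2 K')"
      using that weight_support[OF grad_gen_weight(1)] weight_support[OF grad_gen_weight(2)] assms(1)
      by blast+
    show "\<forall>x\<in>set (proj c w). x < D"
      using grad_gen_indices[OF that] by (auto simp: proj_def)
  qed
  show ?thesis
  proof (cases K)
    case Fld
    then have "grad 1 (gen (Gh 0)) w \<noteq> 0"
      using assms by (auto simp: grad_gen_def)
    from supp[OF this] show ?thesis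
      using assms(1) by (auto simp: Fld valid_gen_def)
  next
    case (Gh m)
    then have nz: "grad (real m + 2) (gen (Gh (m + 1))) w \<noteq> 0"
      using assms by (auto simp: grad_gen_def)
    have "m + 1 < k"
    proof (rule ccontr)
      assume "\<not> m + 1 < k"
      then have "gen (Gh (m + 1)) = 0" by (intro gen_ghost_beyond) simp
      with nz show False by (simp only: grad_zero) simp
    qed
    with supp[OF nz] show ?thesis
      by (auto simp: Gh valid_gen_def)
  qed (use assms in \<open>auto simp: grad_gen_def\<close>)
qed

text \<open>On \<open>\<eta>\<^sup>(\<^sup>0\<^sup>)\<close>, a doublet of the \<open>sl\<^sub>2\<close> mixing the columns, exchanging the columns is \<open>E\<^sub>1\<^sub>2\<close> up to sign. This brings
  \<open>\<gamma> t\<close> to the form that \<open>\<gamma>\<close> has on the ghosts.\<close>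

lemma polar_Deriv_Second_swap:
  assumes "0 < k" "length xs = k" "length ys = k"
  shows "polar Deriv Second (gen (Gh 0)) (normal_word ys xs ds) =
    - polar Deriv First (polar First Second (gen (Gh 0))) (normal_word xs ys ds)"
proof -
  let ?G = "gen (Gh 0)"
  have "polar Deriv Second ?G (normal_word ys xs ds) =
      (-1) ^ (k * k) *\<^sub>R polar Deriv Second ?G (swap_word (normal_word xs ys ds))"
    using supersym_swap_odd_blocks[OF supersym_polar[OF supersym_gen], of First Second Deriv Second "Gh 0" ys xs "map (Pair Deriv) ds"]
      assms by (simp add: normal_word_def odd_slot_def swap_word_def o_def)
  also have "polar Deriv Second ?G (swap_word (normal_word xs ys ds)) =
      polar Deriv First (\<lambda>u. ?G (swap_word u)) (normal_word xs ys ds)"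
    by (simp add: polar_swap_word)
  also have "(\<lambda>u. ?G (swap_word u)) = (-1) ^ (k - 1) *\<^sub>R polar First Second ?G"
  proof
    fix u
    have "polar First Second ?G u = (-1) ^ (k - 1) *\<^sub>R ?G (swap_word u)"
      using weight_gen[of "Gh 0"] young_gen[of "Gh 0"] assms(1) by (intro swap_doublet) simp_all
    then show "?G (swap_word u) = ((-1) ^ (k - 1) *\<^sub>R polar First Second ?G) u"
      by (simp flip: power_mult_distrib)
  qed
  finally have "polar Deriv Second ?G (normal_word ys xs ds) =
      ((-1) ^ (k * k) * (-1) ^ (k - 1)) *\<^sub>R polar Deriv First (polar First Second ?G) (normal_word xs ys ds)"
    by (simp add: polar_scale_app)
  \<comment> \<open>The number k * k + k is even, so the total exponent is odd.\<close>
  moreover have "(-1) ^ (k * k) * (-1) ^ (k - 1) = (-1 :: real)"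
    using assms(1) by (simp add: minus_one_power_iff)
  ultimately show ?thesis by simp
qed

lemma J_gamma_Gen:
  assumes "0 < k"
  shows "J (gamma k D (Gen K xs ys d)) = grad_gen K (normal_word xs ys (sorted_list_of_multiset d))"
proof (cases "valid_gen k D K xs ys d")
  case False
  then have "grad_gen K (normal_word xs ys (sorted_list_of_multiset d)) = 0"
    using grad_gen_support[OF assms, of K "normal_word xs ys (sorted_list_of_multiset d)"] by auto
  then show ?thesis using False by simp
next
  case True
  then have len: "length xs = k" by (simp add: valid_gen_def)
  let ?ds = "sorted_list_of_multiset d"
  have X2: "cls k D (derivs d (curl2 m xs ys)) = (-1) ^ length xs *\<^sub>R polar Deriv Second (gen (Gh m)) (normal_word xs ys ?ds)" for m xs ys
    using polar_Deriv_Second_gen[of m xs ys ?ds] by (simp flip: power_mult_distrib)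
  have X1: "cls k D (derivs d (curl12 m xs ys)) = polar Deriv First (polar First Second (gen (Gh m))) (normal_word xs ys ?ds)" for m
    using polar_curl12_gen[of m xs ys ?ds] by simp
  show ?thesis
  proof (cases K)
    case Fld
    then have len': "length ys = k" using True by (simp add: valid_gen_def)
    show ?thesis
      using True len len' by (simp add: Fld gamma_gen_def grad_gen_def grad_def derivs_Add X2
          polar_Deriv_Second_swap[OF assms len len'] scaleR_diff_right)
  next
    case (Gh m)
    show ?thesis
    proof (cases "m + 2 \<le> k")
      case le: True
      show ?thesis
        using True len le by (simp add: Gh gamma_gen_def grad_gen_def grad_def derivs_Add X2 X1
          cls_derivs_smul algebra_simps flip: power_mult_distrib)
    next
      case False
      then show ?thesis
        using True gen_ghost_beyond[of "m + 1"] by (auto simp: Gh gamma_gen_def grad_gen_def grad_zero derivs_Cst)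
    qed
  qed (use True in \<open>simp_all add: gamma_gen_def grad_gen_def derivs_Cst\<close>)
qed

text \<open>The sign for \<open>m = 0\<close> compensates the factor \<open>(-1)\<^sup>k\<^sup>+\<^sup>1\<close> of \<open>grad_gen Fld\<close>, so that the Laplacian is
  given by one formula throughout.\<close>

definition contract_gen :: "kind \<Rightarrow> nat word \<Rightarrow> locfun" where
  "contract_gen K = (case K of
      Gh m \<Rightarrow> if k \<le> m then 0 else if m = 0 then (-1) ^ k *\<^sub>R polar Second Deriv (gen Fld)
        else - polar Second Deriv (gen (Gh (m - 1)))
    | _ \<Rightarrow> 0)"

text \<open>Realizes \<open>contract_gen\<close> by expressions: a derivative index is appended to
  the second column, and the sign by the lengths is that of an odd operator passing both
  columns.\<close>

fun contract :: "lf \<Rightarrow> lf" where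
  "contract (Gen K xs ys d) = (case K of
      Gh m \<Rightarrow> if valid_gen k D K xs ys d then
        smul ((-1) ^ (length xs + length ys) * (if m = 0 then (-1) ^ k else -1))
          (lsum (map (\<lambda>j. Gen (if m = 0 then Fld else Gh (m - 1)) xs
              (ys @ [sorted_list_of_multiset d ! j]) (mset (delete_at j (sorted_list_of_multiset d))))
            [0..<size d]))
        else Cst 0
    | _ \<Rightarrow> Cst 0)"
| "contract (Cst c) = Cst 0"
| "contract (Add a b) = Add (contract a) (contract b)"
| "contract (Mul a b) = Add (Mul a (contract b)) (Mul (contract a) (par b))"

lemma contract_gen_support:
  assumes "contract_gen K w \<noteq> 0"
  shows "valid_gen k D K (proj First w) (proj Second w) (mset (proj Deriv w))"
proof -
  from assms obtain m where K: "K = Gh m" "m < k"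
    by (cases K) (auto simp: contract_gen_def split: if_splits)
  define K' where "K' = (if m = 0 then Fld else Gh (m - 1))"
  have nz: "polar Second Deriv (gen K') w \<noteq> 0"
    using assms K by (auto simp: contract_gen_def K'_def)
  have "polar First First (polar Second Deriv (gen K')) = real k *\<^sub>R polar Second Deriv (gen K')"
    "polar Second Second (polar Second Deriv (gen K')) = real (k - m - 1) *\<^sub>R polar Second Deriv (gen K')"
    using K by (auto simp: K'_def polar_weight polar_linear weight_gen of_nat_diff scaleR_diff_left scaleR_add_left)
  then have "length (proj First w) = k" "length (proj Second w) = k - m - 1"
    using nz weight_support by blast+
  moreover have "\<forall>l\<in>set w. snd l < D"
    by (rule polar_indices[OF gen_support(3) nz])
  ultimately show ?thesis
    using K by (auto simp: valid_gen_def proj_def)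
qed

lemma polar_Second_Deriv_gen:
  "polar Second Deriv (gen K) (normal_word xs ys ds) = (-1) ^ (length xs + length ys) *\<^sub>R
    (\<Sum>j<length ds. J (Gen K xs (ys @ [ds ! j]) (mset (delete_at j ds))))"
proof -
  have "polar Second Deriv F (map (Pair Deriv) ds) =
      (\<Sum>j<length ds. F (map (Pair Deriv) (take j ds) @ (Second, ds ! j) # map (Pair Deriv) (drop (Suc j) ds)))"
    for F :: "nat word \<Rightarrow> locfun"
    using polar_block_same[of Second Deriv F ds "[]"] by (simp add: odd_slot_def)
  then show ?thesis
    unfolding normal_word_def
    by (simp add: polar_block_other odd_slot_def gen_def inv_sign_append delete_at_def power_add)
qed

lemma J_contract_Gen:
  "J (contract (Gen K xs ys d)) = contract_gen K (normal_word xs ys (sorted_list_of_multiset d))"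
proof (cases "valid_gen k D K xs ys d")
  case False
  then have "contract_gen K (normal_word xs ys (sorted_list_of_multiset d)) = 0"
    using contract_gen_support[of K "normal_word xs ys (sorted_list_of_multiset d)"] by auto
  then show ?thesis using False by (cases K) simp_all
next
  case True
  have len: "length (sorted_list_of_multiset d) = size d"
    by (metis mset_sorted_list_of_multiset size_mset)
  show ?thesis
    using True
    by (cases K) (auto simp: contract_gen_def valid_gen_def polar_Second_Deriv_gen len o_def
        interv_sum_list_conv_sum_set_nat atLeast0LessThan)
qed

section \<open>Compatibility of both derivations with the defining relations\<close>

lemma supersym_minus: "supersym F \<Longrightarrow> supersym (- F)"
  using supersym_scale[of F "-1"] by simp

lemma supersym_contract_gen: "supersym (contract_gen K)"
  unfolding contract_gen_def
  by (cases K) (auto intro: supersym_zero supersym_scale supersym_minus supersym_polar supersym_gen)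

text \<open>Moving \<open>polar Second First\<close> inward through \<open>grad r\<close> leaves (p
  - q - r) times \<open>polar Deriv First\<close>. The coefficients of \<gamma> are exactly those
  with r = p - q.\<close>

lemma young_grad_gen:
  assumes "0 < k"
  shows "polar Second First (grad_gen K) = 0"
proof -
  have *: "polar Second First (grad (real k - real (col2 K')) (gen K')) = 0" for K'
    by (simp add: grad_def polar_linear polar_normal_order weight_gen young_gen algebra_simps)
  show ?thesis
  proof (cases K)
    case Fld
    then show ?thesis using *[of "Gh 0"] assms by (simp add: grad_gen_def polar_linear of_nat_diff)
  next
    case (Gh m)
    show ?thesis
    proof (cases "m + 1 < k")
      case True
      then have "real k - real (col2 (Gh (m + 1))) = real m + 2" by simp
      with *[of "Gh (m + 1)"] show ?thesis unfolding Gh grad_gen_def by (simp only: kind.case)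
    next
      case False
      then show ?thesis
        using gen_ghost_beyond[of "m + 1"] by (simp add: Gh grad_gen_def grad_zero polar_zero)
    qed
  qed (simp_all add: grad_gen_def polar_zero)
qed

lemma young_contract_gen: "polar Second First (contract_gen K) = 0"
  by (cases K) (auto simp: contract_gen_def polar_linear polar_normal_order young_gen)

text \<open>A criterion serving both derivations: column antisymmetry follows from supersymmetry of
  the values on generators, and the Young relation from their annihilation by
  \<open>polar Second First\<close>.\<close>

lemma rels_cancel:
  fixes \<delta> \<Phi>
  assumes Cst: "\<And>c. \<delta> (Cst c) = Cst 0"
    and Add: "\<And>a b. \<delta> (Add a b) = Add (\<delta> a) (\<delta> b)"
    and Mul: "\<And>a b. \<delta> (Mul a b) = Add (Mul a (\<delta> b)) (Mul (\<delta> a) (par b))"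
    and Gen: "\<And>K xs ys d. J (\<delta> (Gen K xs ys d)) = \<Phi> K (normal_word xs ys (sorted_list_of_multiset d))"
    and supersym: "\<And>K. supersym (\<Phi> K)" and young_eq: "\<And>K. polar Second First (\<Phi> K) = 0"
    and invalid: "\<And>K xs ys d. \<not> valid_gen k D K xs ys d \<Longrightarrow> J (\<delta> (Gen K xs ys d)) = 0"
    and exch_eq: "\<And>K xs ys d. K = Fld \<or> K = FldS \<Longrightarrow> J (\<delta> (Gen K xs ys d)) = J (\<delta> (Gen K ys xs d))"
    and r: "r \<in> rels k D"
  shows "J (\<delta> r) = 0"
proof -
  have smul: "J (\<delta> (smul c a)) = c *\<^sub>R J (\<delta> a)" for c a
    by (simp add: smul_def Mul Cst)
  have lsum: "J (\<delta> (lsum es)) = sum_list (map (\<lambda>e. J (\<delta> e)) es)" for es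
    by (induction es) (simp_all add: lsum_def Add Cst)
  show ?thesis
    using r
  proof cases
    case (antisym1 \<sigma> xs K ys d)
    then show ?thesis
      using supersym_permute_odd[OF supersym[of K], of First \<sigma> xs "[]"]
      by (simp add: Add smul Gen normal_word_def odd_slot_def)
  next
    case (antisym2 \<sigma> ys K xs d)
    then show ?thesis
      using supersym_permute_odd[OF supersym[of K], of Second \<sigma> ys "map (Pair First) xs"]
      by (simp add: Add smul Gen normal_word_def odd_slot_def)
  next
    case (young j ys K xs d)
    then show ?thesis
      using polar_young[OF supersym[of K], of j ys xs "sorted_list_of_multiset d"]
      by (simp add: Add smul lsum Gen young_eq o_def interv_sum_list_conv_sum_set_nat atLeast0LessThan)
  next
    case (exch K xs ys d)
    then show ?thesis
      using exch_eq[of K xs ys d] by (simp add: Add smul)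
  qed (simp add: invalid)
qed

lemma parity_hom_curl: "parity_hom (even m) (curl2 m xs ys)" "parity_hom (even m) (curl12 m xs ys)"
  unfolding curl2_def curl12_def by (auto intro!: parity_hom_lsum parity_hom_smul)

lemma parity_gamma_Gen: "parity_hom (\<not> odd_kind K) (gamma k D (Gen K xs ys d))"
  using parity_hom_curl[of 0] parity_hom_curl[of "Suc _"]
  by (cases K) (auto simp: gamma_gen_def intro!: parity_hom_derivs parity_hom_smul)

lemma parity_contract_Gen: "parity_hom (\<not> odd_kind K) (contract (Gen K xs ys d))"
  by (cases K) (auto intro!: parity_hom_lsum parity_hom_smul simp del: parity_hom_smul)

lemma rels_gamma:
  assumes "0 < k" "r \<in> rels k D"
  shows "J (gamma k D r) = 0"
proof (rule rels_cancel[OF _ _ _ J_gamma_Gen[OF assms(1)] supersym_grad_gen young_grad_gen[OF assms(1)] _ _ assms(2)])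
  show "J (gamma k D (Gen K xs ys d)) = J (gamma k D (Gen K ys xs d))" if "K = Fld \<or> K = FldS" for K xs ys d
    using that by (auto simp: valid_gen_def gamma_gen_def derivs_Add add.commute derivs_Cst)
qed simp_all

lemma rels_contract:
  assumes "r \<in> rels k D"
  shows "J (contract r) = 0"
proof (rule rels_cancel[OF _ _ _ J_contract_Gen supersym_contract_gen young_contract_gen _ _ assms])
  show "J (contract (Gen K xs ys d)) = J (contract (Gen K ys xs d))" if "K = Fld \<or> K = FldS" for K xs ys d
    using that by auto
  show "J (contract (Gen K xs ys d)) = 0" if "\<not> valid_gen k D K xs ys d" for K xs ys d
    using that by (cases K) simp_all
qed simp_all

end

section \<open>The complex and its Laplacian on generators\<close>

locale ghost_complex = local_functions +
  assumes k_pos: "0 < k"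
begin

sublocale two_odd_derivations k D "gamma k D" contract
  by unfold_locales (rule gamma.simps contract.simps parity_gamma_Gen parity_contract_Gen
      rels_gamma[OF k_pos] rels_contract | assumption)+

notation g.lift ("\<Gamma>") and h.lift ("H")

lemma lift_gen:
  shows "\<Gamma> (gen K w) = grad_gen K w" and "H (gen K w) = contract_gen K w"
proof -
  have mset: "mset (sorted_list_of_multiset (mset (proj Deriv w))) = mset (proj Deriv w)" by simp
  show "\<Gamma> (gen K w) = grad_gen K w"
    using supersym_normal_mset[OF supersym_grad_gen mset]
    by (simp add: gen_def linear_scale[OF g.linear_lift] J_gamma_Gen[OF k_pos] del: gamma.simps)
  show "H (gen K w) = contract_gen K w"
    using supersym_normal_mset[OF supersym_contract_gen mset]
    by (simp add: gen_def linear_scale[OF h.linear_lift] J_contract_Gen del: contract.simps)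
qed

lemma polar_linear_comp_fun: "linear f \<Longrightarrow> polar i j (\<lambda>u. f (F u)) = (\<lambda>u. f (polar i j F u))"
  by (simp add: fun_eq_iff polar_linear_comp)

lemma grad_linear_comp: "linear f \<Longrightarrow> grad r (\<lambda>u. f (F u)) w = f (grad r F w)"
  by (simp add: grad_def polar_linear_comp_fun linear_diff linear_scale)

text \<open>Applying \<open>\<Gamma>\<close> under \<open>grad\<close> raises the ghost level and
  the parameter by one each, which is the pattern of \<open>grad_grad\<close>.\<close>

lemma grad_gen_closed: "\<Gamma> (grad_gen K w) = 0"
proof -
  have *: "\<Gamma> (grad r (gen (Gh m)) w) = 0" if "r = real m + 1" for r m
  proof -
    have "\<Gamma> (grad r (gen (Gh m)) w) = grad r (\<lambda>u. \<Gamma> (gen (Gh m) u)) w"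
      by (rule grad_linear_comp[OF g.linear_lift, symmetric])
    also have "\<dots> = grad r (grad (r + 1) (gen (Gh (m + 1)))) w"
      by (simp add: lift_gen grad_gen_def that add.commute)
    finally show ?thesis by (simp add: grad_grad)
  qed
  show ?thesis
    by (cases K) (auto simp: grad_gen_def linear_scale[OF g.linear_lift] linear_0[OF g.linear_lift] linear_neg[OF g.linear_lift] *)
qed

lemma gamma_gamma: "J (gamma k D (gamma k D a)) = 0"
proof (rule g.square_zero)
  fix K xs ys d
  have "J (gamma k D (gamma k D (Gen K xs ys d))) = \<Gamma> (J (gamma k D (Gen K xs ys d)))"
    by simp
  also have "\<dots> = 0"
    by (simp only: J_gamma_Gen[OF k_pos] grad_gen_closed)
  finally show "J (gamma k D (gamma k D (Gen K xs ys d))) = 0" .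
qed

lemma lift_lift: "\<Gamma> (\<Gamma> x) = 0"
  unfolding g.lift_def[of x] g.lift_J by (rule gamma_gamma)

lemma casimir_linear_comp: "linear f \<Longrightarrow> casimir (\<lambda>u. f (F u)) w = f (casimir F w)"
  by (simp add: casimir_def polar_linear_comp_fun linear_add)

abbreviation rank_gap :: "kind \<Rightarrow> nat \<Rightarrow> real" where
  "rank_gap K n \<equiv> (real k - real (col2 K)) * (real (col2 K) + real n - 1)"

text \<open>By linearity \<open>\<Gamma>\<close> and \<open>H\<close> act under the polarizations,
  so \<open>laplacian_app\<close> applies with p - q = m + 1. For \<open>Fld\<close> only
  \<open>H\<close> after \<open>\<Gamma>\<close> contributes, and the other term of
  \<open>laplacian_app\<close> vanishes by \<open>raising_eq_0\<close>.\<close>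

lemma laplace_gen:
  assumes K: "K = Fld \<or> (\<exists>m. K = Gh m \<and> m + 1 < k)"
  shows "laplace (gen K w) = rank_gap K (length (proj Deriv w)) *\<^sub>R gen K w + casimir (gen K) w"
  using K
proof (elim disjE exE conjE)
  assume K: "K = Fld"
  interpret young_symmetric "gen Fld" k k
    using young_symmetric_gen[of Fld] by simp
  have "laplace (gen Fld w) = H (\<Gamma> (gen Fld w))"
    by (simp add: laplace_def lift_gen contract_gen_def linear_0[OF g.linear_lift])
  also have "\<dots> = (-1) ^ (k + 1) *\<^sub>R grad 1 (\<lambda>u. H (gen (Gh 0) u)) w"
    by (simp add: lift_gen(1) grad_gen_def linear_scale[OF h.linear_lift] linear_neg[OF h.linear_lift]
        grad_linear_comp[OF h.linear_lift])
  also have "(\<lambda>u. H (gen (Gh 0) u)) = (-1) ^ k *\<^sub>R polar Second Deriv (gen Fld)"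
    using k_pos by (simp add: lift_gen contract_gen_def fun_eq_iff)
  also have "grad 1 \<dots> = (-1) ^ k *\<^sub>R grad 1 (polar Second Deriv (gen Fld))"
    by (simp add: grad_def polar_linear scaleR_diff_right)
  also have "(-1) ^ (k + 1) *\<^sub>R \<dots> w = - grad 1 (polar Second Deriv (gen Fld)) w"
    by (simp flip: power_mult_distrib)
  also have "\<dots> = casimir (gen Fld) w"
    using laplacian_app[of w] raising_eq_0 by (simp add: grad_def polar_linear)
  finally show ?thesis by (simp add: K)
next
  fix m assume K: "K = Gh m" and m: "m + 1 < k"
  interpret young_symmetric "gen K" k "col2 K"
    by (rule young_symmetric_gen)
  have gap: "real k - real (col2 K) = real m + 1"
    using m by (simp add: K)
  have "\<Gamma> (H (gen K w)) = - polar Second Deriv (grad (real m + 1) (gen K)) w"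
  proof (cases "m = 0")
    case True
    have "\<Gamma> (H (gen K w)) = (-1) ^ k *\<^sub>R polar Second Deriv (\<lambda>u. \<Gamma> (gen Fld u)) w"
      using m by (simp add: K True lift_gen(2) contract_gen_def linear_scale[OF g.linear_lift] polar_linear_comp[OF g.linear_lift])
    also have "(\<lambda>u. \<Gamma> (gen Fld u)) = (-1) ^ (k + 1) *\<^sub>R grad 1 (gen K)"
      by (simp add: lift_gen grad_gen_def fun_eq_iff K True)
    finally show ?thesis
      unfolding polar_scale by (simp add: True flip: power_mult_distrib)
  next
    case False
    have "\<Gamma> (H (gen K w)) = - polar Second Deriv (\<lambda>u. \<Gamma> (gen (Gh (m - 1)) u)) w"
      using m False by (simp add: K lift_gen(2) contract_gen_def linear_neg[OF g.linear_lift] polar_linear_comp[OF g.linear_lift])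
    also have "(\<lambda>u. \<Gamma> (gen (Gh (m - 1)) u)) = grad (real m + 1) (gen K)"
      using False by (simp add: lift_gen grad_gen_def fun_eq_iff K of_nat_diff add.commute)
    finally show ?thesis .
  qed
  moreover have "H (\<Gamma> (gen K w)) = - grad (real m + 1 + 1) (polar Second Deriv (gen K)) w"
  proof -
    have "H (\<Gamma> (gen K w)) = grad (real m + 2) (\<lambda>u. H (gen (Gh (m + 1)) u)) w"
      by (simp add: K lift_gen(1) grad_gen_def grad_linear_comp[OF h.linear_lift])
    also have "(\<lambda>u. H (gen (Gh (m + 1)) u)) = - polar Second Deriv (gen K)"
      using m by (simp add: lift_gen contract_gen_def fun_eq_iff K)
    also have "grad (real m + 2) \<dots> = - grad (real m + 2) (polar Second Deriv (gen K))"
      by (simp add: grad_def polar_linear)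
    finally show ?thesis by (simp add: add.assoc)
  qed
  ultimately have "laplace (gen K w) = - (polar Second Deriv (grad (real m + 1) (gen K)) + grad (real m + 1 + 1) (polar Second Deriv (gen K))) w"
    by (simp add: laplace_def)
  also have "\<dots> = rank_gap K (length (proj Deriv w)) *\<^sub>R gen K w + casimir (gen K) w"
    using laplacian_app[of w] unfolding gap by simp
  finally show ?thesis .
qed

section \<open>Eigenvectors of the Laplacian and the sign of their eigenvalues\<close>

definition laplace_by :: "real \<Rightarrow> (nat word \<Rightarrow> locfun) \<Rightarrow> bool" where
  "laplace_by s F \<longleftrightarrow> (\<forall>w. laplace (F w) = s *\<^sub>R F w + casimir F w)"

lemma laplace_by_minus:
  assumes "laplace_by s F"
  shows "laplace_by s (casimir_minus c F)"
    and "laplace (F w) - (s + c) *\<^sub>R F w = casimir_minus c F w"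
proof -
  have F: "(\<lambda>u. laplace (F u)) = s *\<^sub>R F + casimir F"
    using assms by (auto simp: laplace_by_def)
  have "laplace (casimir F w) = casimir (s *\<^sub>R F + casimir F) w" for w
    using casimir_linear_comp[OF linear_laplace, of F w] unfolding F by simp
  then show "laplace_by s (casimir_minus c F)"
    using assms unfolding laplace_by_def
    by (auto simp: casimir_minus_def casimir_linear linear_diff[OF linear_laplace] linear_scale[OF linear_laplace] algebra_simps)
  show "laplace (F w) - (s + c) *\<^sub>R F w = casimir_minus c F w"
    using assms by (simp add: laplace_by_def casimir_minus_def algebra_simps)
qed

text \<open>As \<open>laplace\<close> acts like \<open>casimir\<close> plus the scalar
  \<open>s\<close>, a polynomial annihilating the latter turns into one for the former with all
  roots shifted by \<open>s\<close>.\<close>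

lemma laplace_by_fold:
  assumes "laplace_by s F"
  shows "fold (\<lambda>c x. laplace x - c *\<^sub>R x) (map ((+) s) cs) (F w) = fold casimir_minus cs F w"
  using assms
  by (induction cs arbitrary: F) (simp_all add: laplace_by_minus)

lemma subspace_range_J: "subspace (range J)"
proof (rule subspaceI)
  show "0 \<in> range J" by (metis cls_Cst0 rangeI)
  show "x + y \<in> range J" if "x \<in> range J" "y \<in> range J" for x y
    using that by (auto simp flip: cls_Add)
  show "c *\<^sub>R x \<in> range J" if "x \<in> range J" for c x
    using that by (auto simp flip: cls_Cst_Mul)
qed

lemma laplace_range_J: "laplace x \<in> range J"
  unfolding laplace_def g.lift_def[of "H x"] h.lift_def[of "\<Gamma> x"] by (simp flip: cls_Add)

text \<open>The two sign conditions are compatible with products, under which ghost numbers and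
  eigenvalues both add.\<close>

definition eigens :: "nat \<Rightarrow> locfun set" where
  "eigens n = {x \<in> range J. \<exists>c. laplace x = c *\<^sub>R x \<and> (if n = 0 then 0 \<le> c else 0 < c)}"

lemma gen_in_span_eigens:
  assumes K: "K = Fld \<or> (\<exists>m. K = Gh m \<and> m + 1 < k)" and k: "1 < k"
  shows "gen K w \<in> span (eigens (pgh_kind K))"
proof -
  let ?n = "length (proj Deriv w)"
  let ?F = "at_order ?n (gen K)" and ?q = "col2 K"
  let ?s = "rank_gap K ?n"
  interpret ys: young_symmetric "gen K" k ?q
    by (rule young_symmetric_gen)
  interpret hw: highest_weight ?F "real k" "real ?q" "real ?n"
    by (rule ys.highest_weight_at_order)
  have by_F: "laplace_by ?s ?F"
    unfolding laplace_by_def casimir_at_order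
    by (auto simp: at_order_def laplace_gen[OF K] linear_0[OF linear_laplace])
  have range: "gen K w \<in> range J"
    using subspace_scale[OF subspace_range_J] by (simp add: gen_def)
  have q: "1 \<le> ?q" "?q \<le> k" and gap: "pgh_kind K \<noteq> 0 \<Longrightarrow> ?q < k"
    using K k by auto
  obtain cs where cs: "distinct cs" "fold casimir_minus cs ?F = 0"
    and pos: "\<forall>c\<in>set cs. if pgh_kind K = 0 then 0 \<le> ?s + c else 0 < ?s + c"
  \<comment> \<open>Without derivatives and with \<open>?q\<close> = 1 the roots 0 and q + n - 1
    would coincide, and \<open>?s\<close> would be zero; \<open>casimir_order_0\<close> gives the
    single root k + q instead.\<close>
  proof (cases "?n = 0")
    case True
    have "0 \<le> real ?q - 1" "real ?q \<le> real k" using q by auto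
    then have "0 \<le> ?s" using True by simp
    then have "0 < ?s + (real k + real ?q)" using q by linarith
    moreover have "fold casimir_minus [real k + real ?q] ?F = 0"
      using ys.casimir_order_0 True by (simp add: casimir_minus_def)
    ultimately show ?thesis
      using that[of "[real k + real ?q]"] by simp
  next
    case False
    let ?cs = "[0, real k + real ?n, real ?q + real ?n - 1, real k + real ?q + 2 * real ?n]"
    have n: "1 \<le> real ?n" using False by (cases "proj Deriv w") auto
    have q': "1 \<le> real ?q" "real ?q \<le> real k" using q by auto
    \<comment> \<open>With n \<ge> 1 and 1 \<le> q \<le> k the roots satisfy 0 < q + n - 1 < k + n <
      k + q + 2 n.\<close>
    have "distinct ?cs" using n q' by auto
    moreover have "fold casimir_minus ?cs ?F = 0"
      using hw.casimir_annihilator by (simp add: casimir_minus_def[of 0])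
    moreover have "0 \<le> ?s"
      using n q' by (intro mult_nonneg_nonneg) auto
    moreover have "0 < ?s" if "pgh_kind K \<noteq> 0"
      using n q' gap[OF that] by (intro mult_pos_pos) auto
    ultimately show ?thesis
      using n q' by (intro that[of ?cs]) auto
  qed
  have F: "?F w = gen K w"
    by (simp add: at_order_def)
  have "gen K w \<in> span {x \<in> range J. \<exists>c\<in>set (map ((+) ?s) cs). laplace x = c *\<^sub>R x}"
  proof (rule eigenvector_decomposition[OF linear_laplace subspace_range_J laplace_range_J])
    show "distinct (map ((+) ?s) cs)"
      using cs(1) by (simp add: distinct_map)
    show "fold (\<lambda>c x. laplace x - c *\<^sub>R x) (map ((+) ?s) cs) (gen K w) = 0"
      using laplace_by_fold[OF by_F, of cs w] unfolding F cs(2) by simp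
  qed (rule range)
  moreover have "{x \<in> range J. \<exists>c\<in>set (map ((+) ?s) cs). laplace x = c *\<^sub>R x} \<subseteq> eigens (pgh_kind K)"
    using pos by (auto simp: eigens_def)
  ultimately show ?thesis
    using span_mono by blast
qed

lemma span_eigens:
  assumes "pgh_hom n a" "n \<le> k - 1" and k: "1 < k"
  shows "J a \<in> span (eigens n)"
  using assms(1,2)
proof (induction a arbitrary: n)
  case (Gen K xs ys d)
  show ?case
  proof (cases "K = Fld \<or> (\<exists>m. K = Gh m \<and> m + 1 < k)")
    case True
    then show ?thesis
      using gen_in_span_eigens[OF True k, of "normal_word xs ys (sorted_list_of_multiset d)"] Gen
      by (simp add: gen_normal_word)
  next
    case False
    \<comment> \<open>Ghosts with m + 1 \<ge> k have pure ghost number at least \<open>k\<close> and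
      are excluded by the bound on \<open>n\<close>. Antifields remain, with eigenvalue 0 and ghost
      number 0.\<close>
    have "K = FldS \<or> (\<exists>m. K = GhS m)"
      using False Gen k by (cases K) auto
    moreover from this have "laplace (gen K (normal_word xs ys (sorted_list_of_multiset d))) = 0"
      by (auto simp: laplace_def lift_gen grad_gen_def contract_gen_def linear_0[OF g.linear_lift] linear_0[OF h.linear_lift])
    ultimately have "laplace (J (Gen K xs ys d)) = 0" "n = 0"
      using Gen by (auto simp: gen_normal_word)
    then have "J (Gen K xs ys d) \<in> eigens n"
      by (auto simp: eigens_def intro: exI[of _ 0])
    then show ?thesis by (rule span_base)
  qed
next
  case (Cst c)
  show ?case
  proof (cases "c = 0")
    case False
    have "laplace (J (Cst c)) = 0"
      by (simp add: laplace_def linear_0[OF g.linear_lift] linear_0[OF h.linear_lift])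
    then have "J (Cst c) \<in> eigens n"
      using False Cst by (auto simp: eigens_def intro: exI[of _ 0])
    then show ?thesis by (rule span_base)
  qed (simp add: span_zero)
next
  case (Add a b)
  then show ?case by (simp add: span_add)
next
  case (Mul a b)
  then obtain i where i: "i \<le> n" "pgh_hom i a" "pgh_hom (n - i) b" by auto
  have "J a * J b \<in> span (eigens n)"
  proof (rule span_mult_closed)
    show "J a \<in> span (eigens i)" "J b \<in> span (eigens (n - i))"
      using Mul i by auto
    fix x y assume "x \<in> eigens i" "y \<in> eigens (n - i)"
    then obtain x' y' c d where xy: "x = J x'" "y = J y'" "laplace x = c *\<^sub>R x" "laplace y = d *\<^sub>R y"
      and cd: "if i = 0 then 0 \<le> c else 0 < c" "if n - i = 0 then 0 \<le> d else 0 < d"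
      by (auto simp: eigens_def)
    have "laplace (x * y) = (c + d) *\<^sub>R (x * y)"
      using laplace_mult[of x' y'] xy by (simp add: scaleR_add_left)
    \<comment> \<open>If \<open>n\<close> is positive, so is \<open>i\<close> or
      \<open>n - i\<close>, and that factor brings a strictly positive eigenvalue.\<close>
    moreover have "if n = 0 then 0 \<le> c + d else 0 < c + d"
      using cd i(1) by (auto split: if_splits)
    moreover have "x * y \<in> range J"
      by (simp add: xy flip: cls_Mul)
    ultimately show "x * y \<in> eigens n"
      by (auto simp: eigens_def)
  qed
  then show ?case by (simp add: cls_Mul)
qed

end

theorem theorem1:
  fixes k D l :: nat and a :: lf
  assumes "k > 2" and "D \<ge> 2 * k + 1"
    and "1 \<le> l" and "l \<le> k - 1"
    and "pgh_hom l a"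
    and "lf_eq k D (gamma k D a) (Cst 0)"
  shows "\<exists>b. lf_eq k D a (gamma k D b)"
proof -
  interpret ghost_complex k D
    by unfold_locales (use assms in simp)
  have "J a \<in> span (eigens l)"
    using span_eigens assms by simp
  \<comment> \<open>Here \<open>1 \<le> l\<close> enters: the eigenvalues are strictly positive,
    hence invertible.\<close>
  moreover have "eigens l \<subseteq> {x. \<exists>c. c \<noteq> 0 \<and> g.lift (h.lift x) + h.lift (g.lift x) = c *\<^sub>R x}"
  proof
    fix x assume "x \<in> eigens l"
    then obtain c where "laplace x = c *\<^sub>R x" "0 < c"
      using assms(3) by (auto simp: eigens_def)
    then show "x \<in> {x. \<exists>c. c \<noteq> 0 \<and> g.lift (h.lift x) + h.lift (g.lift x) = c *\<^sub>R x}"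
      unfolding laplace_def by (intro CollectI exI[of _ c]) simp
  qed
  ultimately have "J a \<in> span {x. \<exists>c. c \<noteq> 0 \<and> g.lift (h.lift x) + h.lift (g.lift x) = c *\<^sub>R x}"
    using span_mono by blast
  moreover have "g.lift (J a) = 0"
    using assms(6) by (simp add: cls_eq_0_iff)
  ultimately obtain w where "J a = g.lift w"
    using homotopy_exact[OF g.linear_lift lift_lift h.linear_lift] by blast
  \<comment> \<open>The primitive is the representative of \<open>w\<close> at \<open>k\<close> and
    \<open>D\<close>.\<close>
  then show ?thesis
    unfolding g.lift_def cls_eq_iff by blast
qed

end
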